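(* The class of left Rad-supplemented rings lies properly between the class of semiperfect rings and the class of semilocal rings. That is: (i) every semiperfect ring is Rad-supplemented as a left module over itself; (ii) every ring that is Rad-supplemented as a left module over itself is semilocal; (iii) there exists a semilocal ring that is not Rad-supplemented as a left module over itself; (iv) there exists a ring that is Rad-supplemented as a left module over itself but is not semiperfect.
   Context: All rings are associative with identity and all modules are unital left modules. $\mathrm{Rad}(L)$ denotes the radical of a module $L$: the intersection of all maximal submodules of $L$, or $L$ itself if $L$ has no maximal submodules. $\mathrm{Jac}(R)$ denotes the Jacobson radical of the ring $R$. For submodules $N, L$ of a module $M$, $L$ is called a Rad-supplement (or generalized supplement) of $N$ in $M$ if $N+L=M$ and $N\cap L\subseteq \mathrm{Rad}(L)$. A module $M$ is Rad-supplemented (generalized supplemented) if every submodule of $M$ has a Rad-supplement in $M$. A ring $R$ is semilocal if $R/\mathrm{Jac}(R)$ is semisimple; it is semiperfect if it is semilocal and idempotents lift modulo $\mathrm{Jac}(R)$. *)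

theory Defs
  imports Complex_Main "HOL-Algebra.Module" "HOL-Algebra.QuotRing"
begin

text \<open>
  The library locale \<open>module\<close> requires a commutative ring of scalars, so unital left modules
  over an arbitrary ring get their own locale, on the same record type. The library locale
  \<open>submodule\<close> does not need commutativity and is used as it stands.
\<close>

locale left_module = R?: ring R + M?: abelian_group M
  for R :: "('a, 'm) ring_scheme" (structure) and M :: "('a, 'b, 'n) module_scheme" (structure) +
  assumes smult_closed:
      "\<lbrakk>a \<in> carrier R; x \<in> carrier M\<rbrakk> \<Longrightarrow> a \<odot>\<^bsub>M\<^esub> x \<in> carrier M"
    and smult_l_distr:
      "\<lbrakk>a \<in> carrier R; b \<in> carrier R; x \<in> carrier M\<rbrakk> \<Longrightarrow>
        (a \<oplus>\<^bsub>R\<^esub> b) \<odot>\<^bsub>M\<^esub> x = a \<odot>\<^bsub>M\<^esub> x \<oplus>\<^bsub>M\<^esub> b \<odot>\<^bsub>M\<^esub> x"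
    and smult_r_distr:
      "\<lbrakk>a \<in> carrier R; x \<in> carrier M; y \<in> carrier M\<rbrakk> \<Longrightarrow>
        a \<odot>\<^bsub>M\<^esub> (x \<oplus>\<^bsub>M\<^esub> y) = a \<odot>\<^bsub>M\<^esub> x \<oplus>\<^bsub>M\<^esub> a \<odot>\<^bsub>M\<^esub> y"
    and smult_assoc:
      "\<lbrakk>a \<in> carrier R; b \<in> carrier R; x \<in> carrier M\<rbrakk> \<Longrightarrow>
        (a \<otimes>\<^bsub>R\<^esub> b) \<odot>\<^bsub>M\<^esub> x = a \<odot>\<^bsub>M\<^esub> (b \<odot>\<^bsub>M\<^esub> x)"
    and smult_one:
      "x \<in> carrier M \<Longrightarrow> \<one>\<^bsub>R\<^esub> \<odot>\<^bsub>M\<^esub> x = x"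

text \<open>The fields \<open>mult\<close> and \<open>one\<close> of a module record play no role below.\<close>

definition regular_module :: "('a, 'm) ring_scheme \<Rightarrow> ('a, 'a) module" where
  "regular_module R =
    \<lparr>carrier = carrier R, mult = mult R, one = one R, zero = zero R, add = add R,
     smult = mult R\<rparr>"

lemma (in ring) left_module_regular_module: "left_module R (regular_module R)"
proof -
  have "abelian_group (regular_module R)"
    by (rule abelian_groupI) (auto simp: regular_module_def a_ac intro: l_neg a_inv_closed)
  then show ?thesis
    by (intro left_module.intro left_module_axioms.intro ring_axioms)
      (auto simp: regular_module_def l_distr r_distr m_assoc)
qed

definition maximal_submodule ::
    "'b set \<Rightarrow> ('a, 'm) ring_scheme \<Rightarrow> ('a, 'b, 'n) module_scheme \<Rightarrow> bool" where
  "maximal_submodule N R M \<longleftrightarrow>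
    submodule N R M \<and> N \<noteq> carrier M \<and>
    (\<forall>K. submodule K R M \<and> N \<subseteq> K \<longrightarrow> K = N \<or> K = carrier M)"

text \<open>If there is no maximal submodule, the intersection below is over the empty family,
  hence equal to \<open>UNIV\<close>, and the radical is the whole module.\<close>

definition Rad :: "('a, 'm) ring_scheme \<Rightarrow> ('a, 'b, 'n) module_scheme \<Rightarrow> 'b set" where
  "Rad R M = carrier M \<inter> \<Inter>{N. maximal_submodule N R M}"

definition Jac :: "('a, 'm) ring_scheme \<Rightarrow> 'a set" where
  "Jac R = Rad R (regular_module R)"

definition rad_supplement ::
    "('a, 'm) ring_scheme \<Rightarrow> ('a, 'b, 'n) module_scheme \<Rightarrow> 'b set \<Rightarrow> 'b set \<Rightarrow> bool" where
  "rad_supplement R M N L \<longleftrightarrow>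
    submodule N R M \<and> submodule L R M \<and>
    N <+>\<^bsub>M\<^esub> L = carrier M \<and> N \<inter> L \<subseteq> Rad R (M\<lparr>carrier := L\<rparr>)"

definition rad_supplemented ::
    "('a, 'm) ring_scheme \<Rightarrow> ('a, 'b, 'n) module_scheme \<Rightarrow> bool" where
  "rad_supplemented R M \<longleftrightarrow> (\<forall>N. submodule N R M \<longrightarrow> (\<exists>L. rad_supplement R M N L))"

text \<open>A module is semisimple if each of its submodules is a direct summand.\<close>

definition semisimple_module ::
    "('a, 'm) ring_scheme \<Rightarrow> ('a, 'b, 'n) module_scheme \<Rightarrow> bool" where
  "semisimple_module R M \<longleftrightarrow>
    (\<forall>N. submodule N R M \<longrightarrow>
      (\<exists>K. submodule K R M \<and> N <+>\<^bsub>M\<^esub> K = carrier M \<and> N \<inter> K = {\<zero>\<^bsub>M\<^esub>}))"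

definition semisimple_ring :: "('a, 'm) ring_scheme \<Rightarrow> bool" where
  "semisimple_ring R \<longleftrightarrow> ring R \<and> semisimple_module R (regular_module R)"

definition semilocal_ring :: "('a, 'm) ring_scheme \<Rightarrow> bool" where
  "semilocal_ring R \<longleftrightarrow> ring R \<and> semisimple_ring (R Quot Jac R)"

definition idempotents_lift :: "('a, 'm) ring_scheme \<Rightarrow> 'a set \<Rightarrow> bool" where
  "idempotents_lift R I \<longleftrightarrow>
    (\<forall>x \<in> carrier (R Quot I). x \<otimes>\<^bsub>R Quot I\<^esub> x = x \<longrightarrow>
      (\<exists>e \<in> carrier R. e \<otimes>\<^bsub>R\<^esub> e = e \<and> I +>\<^bsub>R\<^esub> e = x))"

definition semiperfect_ring :: "('a, 'm) ring_scheme \<Rightarrow> bool" where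
  "semiperfect_ring R \<longleftrightarrow> semilocal_ring R \<and> idempotents_lift R (Jac R)"

definition left_rad_supplemented_ring :: "('a, 'm) ring_scheme \<Rightarrow> bool" where
  "left_rad_supplemented_ring R \<longleftrightarrow> ring R \<and> rad_supplemented R (regular_module R)"

end

theory Submission
  imports Defs
begin

text \<open>
  Everything rests on one fact: module homomorphisms map radicals into radicals
  (\<open>Rad_hom\<close>). Write \<open>J\<close> for the Jacobson radical of \<open>R\<close>. Inclusions of left ideals, right
  multiplications and, in a domain, division by a generator are such homomorphisms. Hence \<open>J\<close> is
  two-sided, \<open>Rad L \<subseteq> J\<close> and \<open>J l \<subseteq> Rad L\<close> for every left ideal \<open>L\<close> and every \<open>l \<in> L\<close>. Moreover,
  \<open>R\<close> is semilocal if and only if each left ideal \<open>N \<supseteq> J\<close> has a left ideal \<open>L\<close> with \<open>N + L = R\<close>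
  and \<open>N \<inter> L \<subseteq> J\<close> (\<open>semilocal_ring_imp_complement\<close>, \<open>semilocal_ringI\<close>).

  A Rad-supplement \<open>L\<close> of \<open>N \<supseteq> J\<close> satisfies \<open>N \<inter> L \<subseteq> Rad L \<subseteq> J\<close>, so Rad-supplemented rings are
  semilocal. If \<open>R\<close> is semiperfect, then \<open>N + J = R e + J\<close> for an idempotent \<open>e\<close>, and \<open>R (1 - e)\<close>
  is a Rad-supplement of \<open>N\<close>, because \<open>Rad (R (1 - e)) \<supseteq> J (1 - e)\<close> and \<open>J\<close> is small in \<open>R\<close>.

  A second source of Rad-supplements yields a ring that is not semiperfect: a semilocal ring in
  which every element of \<open>J\<close> is a product of two elements of \<open>J\<close> is Rad-supplemented
  (\<open>semilocal_Jac_idempotent_imp_left_rad_supplemented\<close>), because then \<open>J \<subseteq> Rad L\<close> for every left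
  ideal \<open>L \<supseteq> J\<close>. Both examples are subrings of the reals with two maximal ideals, one above 2 and
  one above 3, and so are semilocal domains; their only idempotents are 0 and 1, while the
  quotient by \<open>J\<close> is a product of two fields.

  For the integers localized at 2 and 3, every ideal is principal. A Rad-supplement \<open>L\<close> of the
  ideal generated by 2 would be generated by some \<open>c \<noteq> 0\<close>, and \<open>2 c \<in> Rad L\<close> would give
  \<open>2 \<in> J\<close>, although 2 is not divisible by 3.

  For the other example, Zorn's lemma provides a subring \<open>A\<close> of the reals that is maximal among
  those which contain neither \<open>1/2\<close> nor \<open>1/3\<close>. Maximality makes \<open>A\<close> closed under square roots of
  its nonnegative elements, since adjoining such a root does not make 2 or 3 invertible.
  Therefore \<open>J\<close> equals its square. Maximality also puts a power of each nonunit \<open>x \<noteq> 0\<close> into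
  \<open>2 A\<close> or \<open>3 A\<close>, since \<open>1/2\<close> or \<open>1/3\<close> must lie in \<open>A[1/x]\<close>. So the radicals of \<open>2 A\<close> and \<open>3 A\<close>
  are the maximal ideals, and \<open>A\<close> is semilocal. The element 3 is idempotent modulo \<open>J\<close>, but it is
  congruent neither to 0 nor to 1.
\<close>

section \<open>Submodules and the radical\<close>

lemma mem_set_add_iff: "x \<in> N <+>\<^bsub>M\<^esub> L \<longleftrightarrow> (\<exists>n\<in>N. \<exists>l\<in>L. x = n \<oplus>\<^bsub>M\<^esub> l)"
  unfolding set_add_def' by blast

lemma mem_set_addE:
  assumes "x \<in> N <+>\<^bsub>M\<^esub> L"
  obtains n l where "n \<in> N" "l \<in> L" "x = n \<oplus>\<^bsub>M\<^esub> l"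
  using assms by (metis mem_set_add_iff)

context abelian_group
begin

lemma add_minus_cancel:
  assumes "x \<in> carrier G" "y \<in> carrier G"
  shows "x \<oplus> y \<ominus> y = x" "y \<oplus> x \<ominus> y = x" "x \<ominus> y \<oplus> y = x" "y \<oplus> (x \<ominus> y) = x"
proof -
  show 1: "x \<oplus> y \<ominus> y = x" using assms by (simp add: a_minus_def a_assoc r_neg)
  then show "y \<oplus> x \<ominus> y = x" using assms a_comm[of x y] by simp
  show 3: "x \<ominus> y \<oplus> y = x" using assms by (simp add: a_minus_def a_assoc l_neg)
  then show "y \<oplus> (x \<ominus> y) = x" using assms a_comm[of "x \<ominus> y" y] by (simp add: a_minus_def)
qed

lemma minus_eq_zero_iff:
  assumes "x \<in> carrier G" "y \<in> carrier G"
  shows "x \<ominus> y = \<zero> \<longleftrightarrow> x = y"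
  using add_minus_cancel(3)[OF assms] assms by (auto simp: a_minus_def r_neg)

end

context left_module
begin

lemma smult_l_zero: "x \<in> carrier M \<Longrightarrow> \<zero>\<^bsub>R\<^esub> \<odot>\<^bsub>M\<^esub> x = \<zero>\<^bsub>M\<^esub>"
  using smult_l_distr[of "\<zero>\<^bsub>R\<^esub>" "\<zero>\<^bsub>R\<^esub>" x] smult_closed[of "\<zero>\<^bsub>R\<^esub>" x]
  by (metis M.add.r_cancel_one' R.add.one_closed R.add.l_one)

lemma smult_neg_one: 
  assumes "x \<in> carrier M" shows "(\<ominus>\<^bsub>R\<^esub> \<one>\<^bsub>R\<^esub>) \<odot>\<^bsub>M\<^esub> x = \<ominus>\<^bsub>M\<^esub> x"
proof -
  have "(\<ominus>\<^bsub>R\<^esub> \<one>\<^bsub>R\<^esub>) \<odot>\<^bsub>M\<^esub> x \<oplus>\<^bsub>M\<^esub> x = (\<ominus>\<^bsub>R\<^esub> \<one>\<^bsub>R\<^esub> \<oplus>\<^bsub>R\<^esub> \<one>\<^bsub>R\<^esub>) \<odot>\<^bsub>M\<^esub> x"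
    using assms by (simp add: smult_l_distr smult_one)
  also have "\<dots> = \<zero>\<^bsub>M\<^esub>" using assms by (simp add: R.l_neg smult_l_zero)
  finally show ?thesis
    using assms by (simp add: M.minus_equality smult_closed)
qed

lemma submodule_iff:
  "submodule N R M \<longleftrightarrow> N \<subseteq> carrier M \<and> \<zero>\<^bsub>M\<^esub> \<in> N \<and>
    (\<forall>x\<in>N. \<forall>y\<in>N. x \<oplus>\<^bsub>M\<^esub> y \<in> N) \<and> (\<forall>a\<in>carrier R. \<forall>x\<in>N. a \<odot>\<^bsub>M\<^esub> x \<in> N)"
  (is "?l \<longleftrightarrow> ?r")
proof
  assume ?l
  then interpret submodule N R M .
  show ?r using subset one_closed m_closed smult_closed by auto
next
  assume r: ?r
  have "\<ominus>\<^bsub>M\<^esub> x \<in> N" if "x \<in> N" for x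
    using r that smult_neg_one[of x] R.a_inv_closed[OF R.one_closed] by force
  with r show ?l
    by (intro submodule.intro subgroup.intro submodule_axioms.intro) (auto simp: a_inv_def)
qed

lemma submodule_minus:
  assumes "submodule N R M" "x \<in> N" "y \<in> N"
  shows "x \<ominus>\<^bsub>M\<^esub> y \<in> N"
proof -
  have "\<ominus>\<^bsub>M\<^esub> y \<in> N"
    using assms smult_neg_one[of y] R.a_inv_closed[OF R.one_closed]
    unfolding submodule_iff by (metis subsetD)
  then show ?thesis using assms unfolding submodule_iff a_minus_def by blast
qed

lemma submodule_set_add:
  assumes N: "submodule N R M" and L: "submodule L R M"
  shows "submodule (N <+>\<^bsub>M\<^esub> L) R M"
proof -
  have c: "n \<in> carrier M" if "n \<in> N \<or> n \<in> L" for n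
    using N L that unfolding submodule_iff by blast
  have "\<zero>\<^bsub>M\<^esub> \<in> N <+>\<^bsub>M\<^esub> L"
    using N L unfolding mem_set_add_iff submodule_iff by (metis M.zero_closed M.r_zero)
  moreover have "(n \<oplus>\<^bsub>M\<^esub> l) \<oplus>\<^bsub>M\<^esub> (n' \<oplus>\<^bsub>M\<^esub> l') \<in> N <+>\<^bsub>M\<^esub> L" 
    if "n \<in> N" "l \<in> L" "n' \<in> N" "l' \<in> L" for n l n' l'
  proof -
    have "(n \<oplus>\<^bsub>M\<^esub> l) \<oplus>\<^bsub>M\<^esub> (n' \<oplus>\<^bsub>M\<^esub> l') = (n \<oplus>\<^bsub>M\<^esub> n') \<oplus>\<^bsub>M\<^esub> (l \<oplus>\<^bsub>M\<^esub> l')"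
      using that by (simp add: c M.a_ac)
    then show ?thesis using N L that unfolding mem_set_add_iff submodule_iff by blast
  qed
  moreover have "a \<odot>\<^bsub>M\<^esub> (n \<oplus>\<^bsub>M\<^esub> l) \<in> N <+>\<^bsub>M\<^esub> L" if "a \<in> carrier R" "n \<in> N" "l \<in> L" for a n l
    using that N L smult_r_distr[of a n l] c unfolding mem_set_add_iff submodule_iff by metis
  moreover have "N <+>\<^bsub>M\<^esub> L \<subseteq> carrier M"
    using c by (auto simp: mem_set_add_iff)
  ultimately show ?thesis
    unfolding submodule_iff by (auto simp: mem_set_add_iff)
qed

lemma subset_set_add:
  assumes "submodule N R M" "submodule L R M"
  shows "N \<subseteq> N <+>\<^bsub>M\<^esub> L" "L \<subseteq> N <+>\<^bsub>M\<^esub> L"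
proof -
  have c: "n \<in> carrier M" if "n \<in> N \<or> n \<in> L" for n
    using assms that unfolding submodule_iff by blast
  have z: "\<zero>\<^bsub>M\<^esub> \<in> N" "\<zero>\<^bsub>M\<^esub> \<in> L" using assms unfolding submodule_iff by blast+
  show "N \<subseteq> N <+>\<^bsub>M\<^esub> L"
  proof
    fix x assume x: "x \<in> N"
    then have "x = x \<oplus>\<^bsub>M\<^esub> \<zero>\<^bsub>M\<^esub>" by (simp add: c)
    then show "x \<in> N <+>\<^bsub>M\<^esub> L" using x z unfolding mem_set_add_iff by blast
  qed
  show "L \<subseteq> N <+>\<^bsub>M\<^esub> L"
  proof
    fix x assume x: "x \<in> L"
    then have "x = \<zero>\<^bsub>M\<^esub> \<oplus>\<^bsub>M\<^esub> x" by (simp add: c)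
    then show "x \<in> N <+>\<^bsub>M\<^esub> L" using x z unfolding mem_set_add_iff by blast
  qed
qed

lemma submodule_left_module:
  assumes N: "submodule N R M"
  shows "left_module R (M\<lparr>carrier := N\<rparr>)"
proof -
  have neg: "\<ominus>\<^bsub>M\<^esub> x \<in> N" if "x \<in> N" for x
    using submodule_minus[OF N, of "\<zero>\<^bsub>M\<^esub>" x] that N unfolding submodule_iff
    by (auto simp: a_minus_def)
  have c: "x \<in> carrier M" if "x \<in> N" for x using N that unfolding submodule_iff by blast
  have "abelian_group (M\<lparr>carrier := N\<rparr>)"
  proof (rule abelian_groupI; simp)
    show "\<exists>y\<in>N. y \<oplus>\<^bsub>M\<^esub> x = \<zero>\<^bsub>M\<^esub>" if "x \<in> N" for x
      using neg[OF that] M.l_neg[OF c[OF that]] by blast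
  qed (use N c in \<open>auto simp: submodule_iff M.a_ac\<close>)
  then show ?thesis
    using N by (intro left_module.intro left_module_axioms.intro R.ring_axioms)
      (auto simp: submodule_iff c smult_l_distr smult_r_distr smult_assoc smult_one)
qed

end

text \<open>
  The preimage of a maximal submodule of \<open>M'\<close> under \<open>f\<close> is either all of \<open>M\<close> or maximal in \<open>M\<close>.
  So an element that lies in all maximal submodules of \<open>M\<close> is mapped into all those of \<open>M'\<close>.
\<close>

theorem Rad_hom:
  assumes M: "left_module R M" and M': "left_module R M'"
    and f: "\<And>x. x \<in> carrier M \<Longrightarrow> f x \<in> carrier M'"
    and f_add: "\<And>x y. x \<in> carrier M \<Longrightarrow> y \<in> carrier M \<Longrightarrow> f (x \<oplus>\<^bsub>M\<^esub> y) = f x \<oplus>\<^bsub>M'\<^esub> f y"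
    and f_smult: "\<And>a x. a \<in> carrier R \<Longrightarrow> x \<in> carrier M \<Longrightarrow> f (a \<odot>\<^bsub>M\<^esub> x) = a \<odot>\<^bsub>M'\<^esub> f x"
    and x: "x \<in> Rad R M"
  shows "f x \<in> Rad R M'"
proof -
  interpret M: left_module R M by (rule M)
  interpret M': left_module R M' by (rule M')
  have f_zero: "f \<zero>\<^bsub>M\<^esub> = \<zero>\<^bsub>M'\<^esub>"
    using f_smult[OF M.R.zero_closed M.M.zero_closed] M.smult_l_zero[OF M.M.zero_closed]
      M'.smult_l_zero[OF f[OF M.M.zero_closed]] by simp
  have f_minus: "f (x \<ominus>\<^bsub>M\<^esub> y) = f x \<ominus>\<^bsub>M'\<^esub> f y" if "x \<in> carrier M" "y \<in> carrier M" for x y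
    using that f_smult[of "\<ominus>\<^bsub>R\<^esub> \<one>\<^bsub>R\<^esub>" y]
    by (simp add: a_minus_def f_add M.smult_neg_one M'.smult_neg_one f)
  have xM: "x \<in> carrier M" using x by (simp add: Rad_def)
  have "f x \<in> K" if K: "maximal_submodule K R M'" for K
  proof (rule ccontr)
    assume fx: "f x \<notin> K"
    have K': "submodule K R M'" using K by (simp add: maximal_submodule_def)
    define P where "P = {y \<in> carrier M. f y \<in> K}"
    have P: "submodule P R M"
      using K' unfolding P_def M.submodule_iff M'.submodule_iff
      by (auto simp: f_zero f_add f_smult M.smult_closed)
    have "maximal_submodule P R M"
      unfolding maximal_submodule_def
    proof (intro conjI allI impI)
      show "P \<noteq> carrier M" using fx xM by (auto simp: P_def)
      fix X assume X: "submodule X R M \<and> P \<subseteq> X"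
      then have XM: "X \<subseteq> carrier M" by (simp add: M.submodule_iff)
      show "X = P \<or> X = carrier M"
      proof (rule disjCI)
        assume "X \<noteq> carrier M"
        show "X = P"
        proof (rule ccontr)
          assume "X \<noteq> P"
          then obtain u where u: "u \<in> X" "u \<notin> P" using X by blast
          have fX: "submodule (f ` X) R M'"
            unfolding M'.submodule_iff
          proof (intro conjI ballI)
            show "f ` X \<subseteq> carrier M'" using XM f by blast
            show "\<zero>\<^bsub>M'\<^esub> \<in> f ` X" 
              using X f_zero[symmetric] unfolding M.submodule_iff by simp
          next
            fix p q assume "p \<in> f ` X" "q \<in> f ` X"
            then show "p \<oplus>\<^bsub>M'\<^esub> q \<in> f ` X"
              using X XM unfolding M.submodule_iff by (auto simp: f_add[symmetric] subset_iff)
          next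
            fix a p assume "a \<in> carrier R" "p \<in> f ` X"
            then show "a \<odot>\<^bsub>M'\<^esub> p \<in> f ` X"
              using X XM unfolding M.submodule_iff by (auto simp: f_smult[symmetric] subset_iff)
          qed
          have "f u \<in> K <+>\<^bsub>M'\<^esub> f ` X" "f u \<notin> K"
            using M'.subset_set_add(2)[OF K' fX] u XM by (auto simp: P_def)
          then have sum: "K <+>\<^bsub>M'\<^esub> f ` X = carrier M'"
            using K M'.submodule_set_add[OF K' fX] M'.subset_set_add(1)[OF K' fX]
            unfolding maximal_submodule_def by blast
          have "m \<in> X" if m: "m \<in> carrier M" for m
          proof -
            obtain k x' where k: "k \<in> K" "x' \<in> X" "f m = k \<oplus>\<^bsub>M'\<^esub> f x'"
              using f[OF m] unfolding sum[symmetric] mem_set_add_iff by blast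
            then have c: "k \<in> carrier M'" "x' \<in> carrier M" "f x' \<in> carrier M'"
              using K' XM f unfolding M'.submodule_iff by auto
            have "f (m \<ominus>\<^bsub>M\<^esub> x') = k \<oplus>\<^bsub>M'\<^esub> f x' \<ominus>\<^bsub>M'\<^esub> f x'"
              using c k m by (simp add: f_minus)
            also have "\<dots> = k"
              using c by (simp add: M'.M.add_minus_cancel)
            finally have "f (m \<ominus>\<^bsub>M\<^esub> x') = k" .
            then have "m \<ominus>\<^bsub>M\<^esub> x' \<in> X" using X k m c by (auto simp: P_def)
            then have "(m \<ominus>\<^bsub>M\<^esub> x') \<oplus>\<^bsub>M\<^esub> x' \<in> X" using X k unfolding M.submodule_iff by blast
            then show ?thesis using m c by (simp add: M.M.add_minus_cancel)
          qed
          then show False using \<open>X \<noteq> carrier M\<close> XM by blast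
        qed
      qed
    qed (rule P)
    then have "x \<in> P" using x by (simp add: Rad_def)
    then show False using fx by (simp add: P_def)
  qed
  then show ?thesis using f xM by (simp add: Rad_def)
qed

lemma (in left_module) Rad_submodule: "submodule (Rad R M) R M"
  unfolding Rad_def maximal_submodule_def submodule_iff by (auto simp: smult_closed)

section \<open>Left ideals and the Jacobson radical\<close>

lemma regular_module_simps [simp]:
  "carrier (regular_module R) = carrier R" "zero (regular_module R) = zero R"
  "add (regular_module R) = add R" "smult (regular_module R) = mult R"
  by (simp_all add: regular_module_def)

lemma set_add_regular_module [simp]: "N <+>\<^bsub>regular_module R\<^esub> L = N <+>\<^bsub>R\<^esub> L"
  by (simp add: set_add_def')

abbreviation left_ideal :: "'a set \<Rightarrow> ('a, 'm) ring_scheme \<Rightarrow> bool" where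
  "left_ideal N R \<equiv> submodule N R (regular_module R)"

context ring
begin

lemma left_ideal_iff:
  "left_ideal N R \<longleftrightarrow> N \<subseteq> carrier R \<and> \<zero> \<in> N \<and>
    (\<forall>x\<in>N. \<forall>y\<in>N. x \<oplus> y \<in> N) \<and> (\<forall>a\<in>carrier R. \<forall>x\<in>N. a \<otimes> x \<in> N)"
  using left_module.submodule_iff[OF left_module_regular_module] by simp

lemma left_ideal_minus:
  assumes "left_ideal N R" "x \<in> N" "y \<in> N"
  shows "x \<ominus> y \<in> N"
proof -
  have "y \<in> carrier R" "\<ominus> \<one> \<otimes> y \<in> N"
    using assms unfolding left_ideal_iff by (blast, simp)
  then show ?thesis using assms unfolding left_ideal_iff
    by (simp add: l_minus a_minus_def)
qed

lemma left_ideal_set_add: "left_ideal N R \<Longrightarrow> left_ideal L R \<Longrightarrow> left_ideal (N <+>\<^bsub>R\<^esub> L) R"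
  using left_module.submodule_set_add[OF left_module_regular_module] by simp

lemma left_ideal_subset_set_add:
  assumes "left_ideal N R" "left_ideal L R"
  shows "N \<subseteq> N <+>\<^bsub>R\<^esub> L" "L \<subseteq> N <+>\<^bsub>R\<^esub> L"
  using left_module.subset_set_add[OF left_module_regular_module assms] by simp_all

lemma left_ideal_one: "left_ideal N R \<Longrightarrow> \<one> \<in> N \<Longrightarrow> N = carrier R"
  unfolding left_ideal_iff using r_one by fastforce

lemma left_ideal_Jac: "left_ideal (Jac R) R"
  unfolding Jac_def by (rule left_module.Rad_submodule[OF left_module_regular_module])

text \<open>
  Right multiplication by \<open>l\<close> is a homomorphism from the regular module to \<open>L\<close>.
\<close>

lemma Jac_mult_Rad:
  assumes L: "left_ideal L R" and "l \<in> L" "j \<in> Jac R"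
  shows "j \<otimes> l \<in> Rad R (regular_module R\<lparr>carrier := L\<rparr>)"
proof (rule Rad_hom[where f = "\<lambda>x. x \<otimes> l" and M = "regular_module R"])
  show "left_module R (regular_module R\<lparr>carrier := L\<rparr>)"
    by (rule left_module.submodule_left_module[OF left_module_regular_module L])
  show "j \<in> Rad R (regular_module R)" using assms by (simp add: Jac_def)
qed (use assms in \<open>auto simp: left_ideal_iff left_module_regular_module l_distr m_assoc subset_iff\<close>)

lemma Rad_left_ideal_subset_Jac:
  assumes L: "left_ideal L R"
  shows "Rad R (regular_module R\<lparr>carrier := L\<rparr>) \<subseteq> Jac R"
proof
  fix x assume x: "x \<in> Rad R (regular_module R\<lparr>carrier := L\<rparr>)"
  show "x \<in> Jac R" unfolding Jac_def
  proof (rule Rad_hom[where f = "\<lambda>x. x" and M = "regular_module R\<lparr>carrier := L\<rparr>"])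
    show "left_module R (regular_module R\<lparr>carrier := L\<rparr>)"
      by (rule left_module.submodule_left_module[OF left_module_regular_module L])
  qed (use x L in \<open>auto simp: left_ideal_iff left_module_regular_module\<close>)
qed

lemma ideal_Jac: "ideal (Jac R) R"
proof (rule idealI)
  show "subgroup (Jac R) (add_monoid R)"
    using submodule.axioms(1)[OF left_ideal_Jac] by (simp add: regular_module_def subgroup_def m_inv_def)
  have e: "regular_module R\<lparr>carrier := carrier R\<rparr> = regular_module R" 
    by (simp add: regular_module_def)
  have "left_ideal (carrier R) R" by (simp add: left_ideal_iff)
  from Jac_mult_Rad[OF this] show "a \<otimes> x \<in> Jac R" if "a \<in> Jac R" "x \<in> carrier R" for a x
    using that unfolding e by (simp add: Jac_def)
  show "x \<otimes> a \<in> Jac R" if "a \<in> Jac R" "x \<in> carrier R" for a x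
    using that left_ideal_Jac by (simp add: left_ideal_iff)
qed (rule ring_axioms)

text \<open>
  Zorn's lemma applies because a left ideal is proper if and only if it omits the unit element, a
  property that unions of chains inherit.
\<close>

lemma maximal_left_ideal_exists:
  assumes N: "left_ideal N R" "\<one> \<notin> N"
  obtains K where "maximal_submodule K R (regular_module R)" "N \<subseteq> K"
proof -
  let ?A = "{K. left_ideal K R \<and> \<one> \<notin> K \<and> N \<subseteq> K}"
  have "\<exists>M\<in>?A. \<forall>X\<in>?A. M \<subseteq> X \<longrightarrow> X = M"
  proof (rule subset_Zorn_nonempty)
    show "?A \<noteq> {}" using N by blast
  next
    fix C assume C: "C \<noteq> {}" "subset.chain ?A C"
    have mem: "left_ideal K R" "\<one> \<notin> K" "N \<subseteq> K" if "K \<in> C" for K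
      using C that by (auto simp: subset.chain_def)
    have "x \<oplus> y \<in> \<Union>C" if xy: "x \<in> \<Union>C" "y \<in> \<Union>C" for x y
    proof -
      obtain K K' where K: "K \<in> C" "x \<in> K" "K' \<in> C" "y \<in> K'" using xy by blast
      then have "K \<subseteq> K' \<or> K' \<subseteq> K" using C(2) by (auto simp: subset.chain_def)
      then obtain K'' where K'': "K'' \<in> C" "x \<in> K''" "y \<in> K''" using K by blast
      then have "x \<oplus> y \<in> K''" using mem(1) unfolding left_ideal_iff by blast
      then show ?thesis using K'' by blast
    qed
    moreover have "\<Union>C \<subseteq> carrier R" using mem(1) unfolding left_ideal_iff by blast
    moreover have "\<zero> \<in> \<Union>C" using C(1) mem(1) unfolding left_ideal_iff by blast
    moreover have "a \<otimes> x \<in> \<Union>C" if "a \<in> carrier R" "x \<in> \<Union>C" for a x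
      using that mem(1) unfolding left_ideal_iff by blast
    ultimately have "left_ideal (\<Union>C) R" unfolding left_ideal_iff by blast
    moreover have "\<one> \<notin> \<Union>C" "N \<subseteq> \<Union>C" using C(1) mem(2,3) by blast+
    ultimately have "left_ideal (\<Union>C) R \<and> \<one> \<notin> \<Union>C \<and> N \<subseteq> \<Union>C" by blast
    then show "\<Union>C \<in> ?A" by simp
  qed
  then obtain M where M: "M \<in> ?A" "\<forall>X\<in>?A. M \<subseteq> X \<longrightarrow> X = M" by (rule bexE)
  have "X = M \<or> X = carrier R" if X: "left_ideal X R" "M \<subseteq> X" for X
  proof (cases "\<one> \<in> X")
    case True
    then show ?thesis using left_ideal_one[OF X(1)] by simp
  next
    case False
    then have "X \<in> ?A" using X M(1) by auto
    then show ?thesis using M(2) X(2) by simp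
  qed
  moreover have "left_ideal M R" "M \<noteq> carrier R" "N \<subseteq> M" using M(1) by auto
  ultimately show ?thesis
    by (intro that[of M]) (auto simp: maximal_submodule_def)
qed

text \<open>
  Nakayama's lemma for the regular module: a maximal left ideal that contains \<open>N\<close> would also
  contain the Jacobson radical.
\<close>

lemma Jac_small:
  assumes N: "left_ideal N R" and sum: "N <+>\<^bsub>R\<^esub> Jac R = carrier R"
  shows "N = carrier R"
proof (rule ccontr)
  assume "N \<noteq> carrier R"
  then have "\<one> \<notin> N" using left_ideal_one N by blast
  then obtain K where K: "maximal_submodule K R (regular_module R)" "N \<subseteq> K"
    using maximal_left_ideal_exists N by blast
  then have "Jac R \<subseteq> K" "left_ideal K R" "K \<noteq> carrier R"
    by (auto simp: Jac_def Rad_def maximal_submodule_def)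
  then have "N <+>\<^bsub>R\<^esub> Jac R \<subseteq> K"
    using K(2) unfolding left_ideal_iff mem_set_add_iff subset_iff by blast
  then show False using sum \<open>left_ideal K R\<close> \<open>K \<noteq> carrier R\<close> unfolding left_ideal_iff by blast
qed

end

section \<open>Semilocal rings\<close>

context ring_hom_ring
begin

text \<open>
  This lemma and the next one express semisimplicity of a homomorphic image by left ideals of \<open>R\<close>
  alone, through the correspondence between left ideals of \<open>S\<close> and left ideals of \<open>R\<close> that contain
  the kernel. The complement obtained here contains the kernel; the next lemma asks for less.
\<close>

lemma semisimple_ring_imp_complement:
  assumes surj: "h ` carrier R = carrier S" and S: "semisimple_ring S"
    and N: "left_ideal N R" "a_kernel R S h \<subseteq> N"
  obtains L where "left_ideal L R" "a_kernel R S h \<subseteq> L"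
    "N <+>\<^bsub>R\<^esub> L = carrier R" "N \<inter> L \<subseteq> a_kernel R S h"
proof -
  have hN: "left_ideal (h ` N) S"
    unfolding S.left_ideal_iff
  proof (intro conjI ballI)
    have NR: "N \<subseteq> carrier R" using N unfolding R.left_ideal_iff by blast
    then show "h ` N \<subseteq> carrier S" by auto
    have "\<zero> \<in> N" using N unfolding R.left_ideal_iff by blast
    then show "\<zero>\<^bsub>S\<^esub> \<in> h ` N" using hom_zero by (metis imageI)
    show "x \<oplus>\<^bsub>S\<^esub> y \<in> h ` N" if xy: "x \<in> h ` N" "y \<in> h ` N" for x y
    proof -
      obtain n n' where n: "n \<in> N" "n' \<in> N" "x = h n" "y = h n'" using xy by blast
      then have "x \<oplus>\<^bsub>S\<^esub> y = h (n \<oplus> n')" using NR by (simp add: subset_iff)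
      then show ?thesis using N n unfolding R.left_ideal_iff by blast
    qed
    show "s \<otimes>\<^bsub>S\<^esub> x \<in> h ` N" if sx: "s \<in> carrier S" "x \<in> h ` N" for s x
    proof -
      obtain r n where n: "r \<in> carrier R" "s = h r" "n \<in> N" "x = h n"
        using sx surj by blast
      then have "s \<otimes>\<^bsub>S\<^esub> x = h (r \<otimes> n)" using NR by (simp add: subset_iff)
      then show ?thesis using N n unfolding R.left_ideal_iff by blast
    qed
  qed
  then obtain K where K: "left_ideal K S" "h ` N <+>\<^bsub>S\<^esub> K = carrier S" "h ` N \<inter> K = {\<zero>\<^bsub>S\<^esub>}"
    using S by (auto simp: semisimple_ring_def semisimple_module_def)
  define L where "L = {r \<in> carrier R. h r \<in> K}"
  show thesis
  proof
    show L: "left_ideal L R"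
      using K(1) unfolding R.left_ideal_iff S.left_ideal_iff L_def by auto
    show "a_kernel R S h \<subseteq> L"
      using K(1) unfolding S.left_ideal_iff L_def a_kernel_def' by auto
    show "N \<inter> L \<subseteq> a_kernel R S h"
    proof
      fix x assume x: "x \<in> N \<inter> L"
      then have "h x \<in> h ` N \<inter> K" by (simp add: L_def)
      then have "h x = \<zero>\<^bsub>S\<^esub>" unfolding K(3) by simp
      then show "x \<in> a_kernel R S h" using x unfolding a_kernel_def' by (simp add: L_def)
    qed
    show "N <+>\<^bsub>R\<^esub> L = carrier R"
    proof
      show "N <+>\<^bsub>R\<^esub> L \<subseteq> carrier R"
        using R.left_ideal_set_add[OF N(1) L] unfolding R.left_ideal_iff by blast
      show "carrier R \<subseteq> N <+>\<^bsub>R\<^esub> L"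
      proof
        fix r assume r: "r \<in> carrier R"
        then have "h r \<in> h ` N <+>\<^bsub>S\<^esub> K" using K(2) by simp
        then obtain n k where nk: "n \<in> N" "k \<in> K" "h r = h n \<oplus>\<^bsub>S\<^esub> k"
          by (fast elim: mem_set_addE)
        have c: "n \<in> carrier R" "k \<in> carrier S"
          using N K(1) nk unfolding R.left_ideal_iff S.left_ideal_iff by blast+
        have "h (r \<ominus> n) = h n \<oplus>\<^bsub>S\<^esub> k \<ominus>\<^bsub>S\<^esub> h n"
          using r c nk by (simp add: a_minus_def)
        also have "\<dots> = k"
          using c by (simp add: S.add_minus_cancel)
        finally have "r \<ominus> n \<in> L" using nk r c by (simp add: L_def)
        moreover have "r = n \<oplus> (r \<ominus> n)"
          using r c by (simp add: R.add_minus_cancel)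
        ultimately show "r \<in> N <+>\<^bsub>R\<^esub> L" using nk unfolding mem_set_add_iff by blast
      qed
    qed
  qed
qed

lemma semisimple_ringI:
  assumes surj: "h ` carrier R = carrier S"
    and compl: "\<And>N. left_ideal N R \<Longrightarrow> a_kernel R S h \<subseteq> N \<Longrightarrow>
      \<exists>L. left_ideal L R \<and> N <+>\<^bsub>R\<^esub> L = carrier R \<and> N \<inter> L \<subseteq> a_kernel R S h"
  shows "semisimple_ring S"
proof -
  have "\<exists>K. left_ideal K S \<and> N <+>\<^bsub>S\<^esub> K = carrier S \<and> N \<inter> K = {\<zero>\<^bsub>S\<^esub>}"
    if N: "left_ideal N S" for N
  proof -
    define N' where "N' = {r \<in> carrier R. h r \<in> N}"
    have "left_ideal N' R"
      using N unfolding R.left_ideal_iff S.left_ideal_iff N'_def by auto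
    moreover have "a_kernel R S h \<subseteq> N'"
      using N unfolding S.left_ideal_iff N'_def a_kernel_def' by auto
    ultimately obtain L where L: "left_ideal L R" "N' <+>\<^bsub>R\<^esub> L = carrier R"
        "N' \<inter> L \<subseteq> a_kernel R S h"
      using compl by blast
    have LR: "L \<subseteq> carrier R" using L unfolding R.left_ideal_iff by blast
    have K: "left_ideal (h ` L) S"
      unfolding S.left_ideal_iff
    proof (intro conjI ballI)
      show "h ` L \<subseteq> carrier S" using LR by auto
      have "\<zero> \<in> L" using L unfolding R.left_ideal_iff by blast
      then show "\<zero>\<^bsub>S\<^esub> \<in> h ` L" using hom_zero by (metis imageI)
      show "x \<oplus>\<^bsub>S\<^esub> y \<in> h ` L" if xy: "x \<in> h ` L" "y \<in> h ` L" for x y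
      proof -
        obtain n n' where n: "n \<in> L" "n' \<in> L" "x = h n" "y = h n'" using xy by blast
        then have "x \<oplus>\<^bsub>S\<^esub> y = h (n \<oplus> n')" using LR by (simp add: subset_iff)
        then show ?thesis using L n unfolding R.left_ideal_iff by blast
      qed
      show "s \<otimes>\<^bsub>S\<^esub> x \<in> h ` L" if sx: "s \<in> carrier S" "x \<in> h ` L" for s x
      proof -
        obtain r n where n: "r \<in> carrier R" "s = h r" "n \<in> L" "x = h n"
          using sx surj by blast
        then have "s \<otimes>\<^bsub>S\<^esub> x = h (r \<otimes> n)" using LR by (simp add: subset_iff)
        then show ?thesis using L n unfolding R.left_ideal_iff by blast
      qed
    qed
    moreover have "N <+>\<^bsub>S\<^esub> h ` L = carrier S"
    proof
      show "N <+>\<^bsub>S\<^esub> h ` L \<subseteq> carrier S"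
        using S.left_ideal_set_add[OF N K] unfolding S.left_ideal_iff by blast
      show "carrier S \<subseteq> N <+>\<^bsub>S\<^esub> h ` L"
      proof
        fix s assume "s \<in> carrier S"
        then obtain r where r: "r \<in> carrier R" "s = h r" unfolding surj[symmetric] by blast
        then have "r \<in> N' <+>\<^bsub>R\<^esub> L" unfolding L(2) by simp
        then obtain n l where nl: "n \<in> N'" "l \<in> L" "r = n \<oplus> l" by (rule mem_set_addE)
        then have "h n \<in> N" "l \<in> L" "s = h n \<oplus>\<^bsub>S\<^esub> h l"
          using LR r(2) by (auto simp: N'_def)
        then show "s \<in> N <+>\<^bsub>S\<^esub> h ` L" unfolding mem_set_add_iff by blast
      qed
    qed
    moreover have "N \<inter> h ` L = {\<zero>\<^bsub>S\<^esub>}"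
    proof
      show "N \<inter> h ` L \<subseteq> {\<zero>\<^bsub>S\<^esub>}"
      proof
        fix s assume "s \<in> N \<inter> h ` L"
        then obtain l where "l \<in> L" "s = h l" "h l \<in> N" by blast
        then have "l \<in> N' \<inter> L" using LR by (auto simp: N'_def)
        then have "l \<in> a_kernel R S h" by (rule subsetD[OF L(3)])
        then show "s \<in> {\<zero>\<^bsub>S\<^esub>}" using \<open>s = h l\<close> by simp
      qed
      show "{\<zero>\<^bsub>S\<^esub>} \<subseteq> N \<inter> h ` L" using N K unfolding S.left_ideal_iff by blast
    qed
    ultimately show ?thesis by blast
  qed
  then show ?thesis
    by (simp add: semisimple_ring_def semisimple_module_def S.ring_axioms)
qed

end

context ring
begin

lemma ring_hom_quotient_Jac: "ring_hom_ring R (R Quot Jac R) ((+>) (Jac R))"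
  by (rule ideal.rcos_ring_hom_ring[OF ideal_Jac])

lemma quotient_Jac_surj: "(+>) (Jac R) ` carrier R = carrier (R Quot Jac R)"
  by (auto simp: FactRing_def A_RCOSETS_def')

lemma kernel_quotient_Jac: "a_kernel R (R Quot Jac R) ((+>) (Jac R)) = Jac R"
proof -
  interpret J: ideal "Jac R" R by (rule ideal_Jac)
  have "x \<in> Jac R" if "x \<in> carrier R" "Jac R +> x = Jac R" for x
    using J.a_rcos_self[OF that(1)] that(2) by simp
  then show ?thesis
    using J.a_rcos_const by (auto simp: a_kernel_def' FactRing_def)
qed

lemma semilocal_ring_imp_complement:
  assumes "semilocal_ring R" "left_ideal N R" "Jac R \<subseteq> N"
  obtains L where "left_ideal L R" "Jac R \<subseteq> L" "N <+>\<^bsub>R\<^esub> L = carrier R" "N \<inter> L \<subseteq> Jac R"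
  using ring_hom_ring.semisimple_ring_imp_complement[OF ring_hom_quotient_Jac quotient_Jac_surj, of N]
    assms by (auto simp: kernel_quotient_Jac semilocal_ring_def)

lemma semilocal_ringI:
  assumes "\<And>N. left_ideal N R \<Longrightarrow> Jac R \<subseteq> N \<Longrightarrow>
      \<exists>L. left_ideal L R \<and> N <+>\<^bsub>R\<^esub> L = carrier R \<and> N \<inter> L \<subseteq> Jac R"
  shows "semilocal_ring R"
  using ring_hom_ring.semisimple_ringI[OF ring_hom_quotient_Jac quotient_Jac_surj] assms
  by (simp add: kernel_quotient_Jac semilocal_ring_def ring_axioms)

lemma idempotents_lift_Jac_iff:
  "idempotents_lift R (Jac R) \<longleftrightarrow>
    (\<forall>a\<in>carrier R. a \<otimes> a \<ominus> a \<in> Jac R \<longrightarrow>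
      (\<exists>e\<in>carrier R. e \<otimes> e = e \<and> e \<ominus> a \<in> Jac R))"
proof -
  interpret h: ring_hom_ring R "R Quot Jac R" "(+>) (Jac R)" by (rule ring_hom_quotient_Jac)
  have eq: "Jac R +> x = Jac R +> y \<longleftrightarrow> x \<ominus> y \<in> Jac R" 
    if xy: "x \<in> carrier R" "y \<in> carrier R" for x y
  proof -
    let ?q = "(+>) (Jac R)"
    have q: "?q x \<in> carrier (R Quot Jac R)" "?q y \<in> carrier (R Quot Jac R)"
      using xy by (simp_all only: h.hom_closed)
    have "?q (x \<ominus> y) = ?q x \<ominus>\<^bsub>R Quot Jac R\<^esub> ?q y"
      using xy by (simp only: a_minus_def h.hom_add h.hom_a_inv a_inv_closed)
    then have "?q x = ?q y \<longleftrightarrow> ?q (x \<ominus> y) = \<zero>\<^bsub>R Quot Jac R\<^esub>"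
      using h.S.minus_eq_zero_iff[OF q] by simp
    also have "\<dots> \<longleftrightarrow> x \<ominus> y \<in> a_kernel R (R Quot Jac R) ?q"
      unfolding a_kernel_def' using xy by blast
    finally show ?thesis unfolding kernel_quotient_Jac .
  qed
  have lift: "(\<exists>e\<in>carrier R. e \<otimes> e = e \<and> Jac R +> e = Jac R +> a) \<longleftrightarrow>
      (\<exists>e\<in>carrier R. e \<otimes> e = e \<and> e \<ominus> a \<in> Jac R)" if "a \<in> carrier R" for a
    using eq that by blast
  have idem: "(Jac R +> a) \<otimes>\<^bsub>R Quot Jac R\<^esub> (Jac R +> a) = Jac R +> a \<longleftrightarrow> a \<otimes> a \<ominus> a \<in> Jac R"
    if "a \<in> carrier R" for a
    using eq[of "a \<otimes> a" a] that h.hom_mult[of a a] by simp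
  show ?thesis
    unfolding idempotents_lift_def quotient_Jac_surj[symmetric] ball_simps
    using lift idem by simp
qed

lemma left_rad_supplemented_ring_iff:
  "left_rad_supplemented_ring R \<longleftrightarrow> (\<forall>N. left_ideal N R \<longrightarrow> (\<exists>L. left_ideal L R \<and>
    N <+>\<^bsub>R\<^esub> L = carrier R \<and> N \<inter> L \<subseteq> Rad R (regular_module R\<lparr>carrier := L\<rparr>)))"
  by (auto simp: left_rad_supplemented_ring_def rad_supplemented_def rad_supplement_def
      ring_axioms)

theorem left_rad_supplemented_ring_imp_semilocal:
  assumes "left_rad_supplemented_ring R"
  shows "semilocal_ring R"
proof (rule semilocal_ringI)
  fix N assume N: "left_ideal N R"
  then show "\<exists>L. left_ideal L R \<and> N <+>\<^bsub>R\<^esub> L = carrier R \<and> N \<inter> L \<subseteq> Jac R"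
    using assms Rad_left_ideal_subset_Jac unfolding left_rad_supplemented_ring_iff by fast
qed

text \<open>
  Modulo the Jacobson radical, \<open>N\<close> is a direct summand and hence generated by an idempotent. A lift
  \<open>e\<close> of this idempotent decomposes \<open>R\<close> itself, and \<open>R (1 - e)\<close> is the required Rad-supplement.
\<close>

theorem semiperfect_ring_imp_left_rad_supplemented:
  assumes "semiperfect_ring R"
  shows "left_rad_supplemented_ring R"
  unfolding left_rad_supplemented_ring_iff
proof (intro allI impI)
  fix N assume N: "left_ideal N R"
  interpret J: ideal "Jac R" R by (rule ideal_Jac)
  let ?M = "N <+>\<^bsub>R\<^esub> Jac R"
  have M: "left_ideal ?M R" "N \<subseteq> ?M" "Jac R \<subseteq> ?M"
    using left_ideal_set_add left_ideal_subset_set_add N left_ideal_Jac by blast+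
  obtain K where K: "left_ideal K R" "Jac R \<subseteq> K" "?M <+>\<^bsub>R\<^esub> K = carrier R" "?M \<inter> K \<subseteq> Jac R"
    using semilocal_ring_imp_complement[OF _ M(1,3)] assms by (auto simp: semiperfect_ring_def)
  have "\<one> \<in> ?M <+>\<^bsub>R\<^esub> K" by (simp add: K)
  then obtain a b where ab: "a \<in> ?M" "b \<in> K" "\<one> = a \<oplus> b" by (rule mem_set_addE)
  have c: "a \<in> carrier R" "b \<in> carrier R"
    using ab M K unfolding left_ideal_iff by blast+
  have b: "b = \<one> \<ominus> a" using c ab(3) by (simp add: add_minus_cancel)
  \<comment> \<open>Right multiplication by \<open>a\<close> is, modulo the radical, the identity on \<open>?M\<close>.\<close>
  have mb: "m \<otimes> b \<in> Jac R" if m: "m \<in> ?M" for m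
  proof -
    have mR: "m \<in> carrier R" using m M unfolding left_ideal_iff by blast
    then have "m \<otimes> b = m \<ominus> m \<otimes> a" using c by (simp add: b a_minus_def r_distr r_minus)
    moreover have "m \<otimes> a \<in> ?M" "m \<otimes> b \<in> K"
      using mR M K ab unfolding left_ideal_iff by blast+
    ultimately show ?thesis using left_ideal_minus[OF M(1) m] K(4) by auto
  qed
  have "a \<otimes> a \<ominus> a = \<ominus> (a \<otimes> b)"
    using c by (simp add: b a_minus_def r_distr r_minus minus_add a_ac)
  then have "a \<otimes> a \<ominus> a \<in> Jac R" using mb[OF ab(1)] by simp
  then obtain e where e: "e \<in> carrier R" "e \<otimes> e = e" "e \<ominus> a \<in> Jac R"
    using assms c unfolding semiperfect_ring_def idempotents_lift_Jac_iff by blast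
  define f where "f = \<one> \<ominus> e"
  have f: "f \<in> carrier R" "f \<otimes> f = f"
    using e by (simp_all add: f_def a_minus_def r_distr l_distr r_minus l_minus a_ac r_neg r_neg1)
  have ef: "\<one> = e \<oplus> f" using e by (simp add: f_def add_minus_cancel)
  define L where "L = (\<lambda>r. r \<otimes> f) ` carrier R"
  have L: "left_ideal L R"
    unfolding left_ideal_iff
  proof (intro conjI ballI)
    show "L \<subseteq> carrier R" using f by (auto simp: L_def)
    show "\<zero> \<in> L" using f unfolding L_def by (intro image_eqI[of _ _ "\<zero>"]) auto
    show "x \<oplus> y \<in> L" if xy: "x \<in> L" "y \<in> L" for x y
    proof -
      obtain r s where "r \<in> carrier R" "s \<in> carrier R" "x = r \<otimes> f" "y = s \<otimes> f"
        using xy by (auto simp: L_def)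
      then show ?thesis
        using f unfolding L_def by (intro image_eqI[of _ _ "r \<oplus> s"]) (auto simp: l_distr)
    qed
    show "x \<otimes> y \<in> L" if xy: "x \<in> carrier R" "y \<in> L" for x y
    proof -
      obtain s where "s \<in> carrier R" "y = s \<otimes> f" using xy by (auto simp: L_def)
      then show ?thesis
        using f xy unfolding L_def by (intro image_eqI[of _ _ "x \<otimes> s"]) (auto simp: m_assoc)
    qed
  qed
  have fL: "f \<in> L" using f unfolding L_def by (intro image_eqI[of _ _ "\<one>"]) auto
  have "N <+>\<^bsub>R\<^esub> L = carrier R"
  proof (rule Jac_small)
    show NL: "left_ideal (N <+>\<^bsub>R\<^esub> L) R" by (rule left_ideal_set_add[OF N L])
    have "e = a \<oplus> (e \<ominus> a)" using e c by (simp add: add_minus_cancel)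
    moreover have "a \<oplus> (e \<ominus> a) \<in> ?M"
      using ab(1) e(3) M(1) M(3)[THEN subsetD, of "e \<ominus> a"] unfolding left_ideal_iff by blast
    ultimately have "e \<in> ?M" by simp
    then obtain n j where nj: "n \<in> N" "j \<in> Jac R" "e = n \<oplus> j" by (rule mem_set_addE)
    have "n \<in> carrier R" using N nj unfolding left_ideal_iff by blast
    then have "\<one> = (n \<oplus> f) \<oplus> j" using f ef nj J.Icarr[OF nj(2)] by (simp add: a_ac)
    moreover have "n \<oplus> f \<in> N <+>\<^bsub>R\<^esub> L" using nj(1) fL unfolding mem_set_add_iff by blast
    ultimately have "\<one> \<in> (N <+>\<^bsub>R\<^esub> L) <+>\<^bsub>R\<^esub> Jac R"
      using nj(2) mem_set_add_iff[where N = "N <+>\<^bsub>R\<^esub> L"] by blast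
    then show "(N <+>\<^bsub>R\<^esub> L) <+>\<^bsub>R\<^esub> Jac R = carrier R"
      by (rule left_ideal_one[OF left_ideal_set_add[OF NL left_ideal_Jac]])
  qed
  moreover have "x \<in> Rad R (regular_module R\<lparr>carrier := L\<rparr>)" if x: "x \<in> N \<inter> L" for x
  proof -
    obtain r where r: "r \<in> carrier R" "x = r \<otimes> f" using x by (auto simp: L_def)
    then have xf: "x \<in> carrier R" "x = x \<otimes> f" using f by (simp_all add: m_assoc)
    \<comment> \<open>On \<open>N\<close>, right multiplication by \<open>f\<close> agrees with that by \<open>b\<close> modulo the radical.\<close>
    have "f \<oplus> (e \<ominus> a) = f \<oplus> e \<ominus> a" using e c f by (simp add: a_minus_def a_assoc)
    also have "\<dots> = b" using e f ef by (simp add: b a_comm)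
    finally have "x \<otimes> b = x \<otimes> f \<oplus> x \<otimes> (e \<ominus> a)" using xf(1) e c f by (simp flip: r_distr)
    then have "x \<otimes> f = x \<otimes> b \<ominus> x \<otimes> (e \<ominus> a)"
      using xf(1) e c f by (simp add: add_minus_cancel)
    moreover have "x \<otimes> b \<in> Jac R" using mb x M by blast
    moreover have "x \<otimes> (e \<ominus> a) \<in> Jac R" using e xf J.I_l_closed by blast
    ultimately have "x \<otimes> f \<in> Jac R" using left_ideal_minus[OF left_ideal_Jac] by simp
    then have "x \<in> Jac R" using xf by simp
    then show ?thesis using Jac_mult_Rad[OF L fL] xf by metis
  qed
  ultimately show "\<exists>L. left_ideal L R \<and> N <+>\<^bsub>R\<^esub> L = carrier R \<and>
      N \<inter> L \<subseteq> Rad R (regular_module R\<lparr>carrier := L\<rparr>)"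
    using L by blast
qed

text \<open>
  If a left ideal \<open>L\<close> contains the Jacobson radical \<open>J\<close>, then \<open>J = J J \<subseteq> J L \<subseteq> Rad L\<close>. So a
  complement of \<open>N + J\<close> modulo \<open>J\<close> is already a Rad-supplement of \<open>N\<close>.
\<close>

theorem semilocal_Jac_idempotent_imp_left_rad_supplemented:
  assumes sl: "semilocal_ring R"
    and idem: "\<And>x. x \<in> Jac R \<Longrightarrow> \<exists>u\<in>Jac R. \<exists>v\<in>Jac R. x = u \<otimes> v"
  shows "left_rad_supplemented_ring R"
  unfolding left_rad_supplemented_ring_iff
proof (intro allI impI)
  fix N assume N: "left_ideal N R"
  let ?M = "N <+>\<^bsub>R\<^esub> Jac R"
  have M: "left_ideal ?M R" "N \<subseteq> ?M" "Jac R \<subseteq> ?M"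
    using left_ideal_set_add left_ideal_subset_set_add N left_ideal_Jac by blast+
  obtain L where L: "left_ideal L R" "Jac R \<subseteq> L" "?M <+>\<^bsub>R\<^esub> L = carrier R" "?M \<inter> L \<subseteq> Jac R"
    using semilocal_ring_imp_complement[OF sl M(1,3)] .
  have "\<one> \<in> ?M <+>\<^bsub>R\<^esub> L" by (simp add: L)
  then obtain m l where ml: "m \<in> ?M" "l \<in> L" "\<one> = m \<oplus> l" by (rule mem_set_addE)
  from ml(1) obtain n j where nj: "n \<in> N" "j \<in> Jac R" "m = n \<oplus> j" by (rule mem_set_addE)
  note njl = nj(1,2) ml(2) ml(3)[unfolded nj(3)]
  then have "n \<in> carrier R" "j \<in> carrier R" "l \<in> carrier R"
    using N L left_ideal_Jac unfolding left_ideal_iff by blast+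
  then have "\<one> = n \<oplus> (j \<oplus> l)" using njl by (simp add: a_assoc)
  moreover have "j \<oplus> l \<in> L" using L njl unfolding left_ideal_iff by blast
  ultimately have "\<one> \<in> N <+>\<^bsub>R\<^esub> L" using njl unfolding mem_set_add_iff by blast
  then have "N <+>\<^bsub>R\<^esub> L = carrier R" by (rule left_ideal_one[OF left_ideal_set_add[OF N L(1)]])
  moreover have "x \<in> Rad R (regular_module R\<lparr>carrier := L\<rparr>)" if "x \<in> N \<inter> L" for x
  proof -
    have "x \<in> Jac R" using that M L by blast
    then obtain u v where "u \<in> Jac R" "v \<in> Jac R" "x = u \<otimes> v" using idem by blast
    then show ?thesis using Jac_mult_Rad[OF L(1)] L(2) by blast
  qed
  ultimately show "\<exists>L. left_ideal L R \<and> N <+>\<^bsub>R\<^esub> L = carrier R \<and>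
      N \<inter> L \<subseteq> Rad R (regular_module R\<lparr>carrier := L\<rparr>)"
    using L by blast
qed

end

section \<open>Rings with exactly two maximal left ideals\<close>

text \<open>
  The assumptions are arranged so that no maximality has to be verified in the examples: \<open>P\<close> and
  \<open>Q\<close> are comaximal and together control all proper left ideals, which makes them the only maximal
  ones.
\<close>

locale two_maximal_left_ideals = ring R for R (structure) +
  fixes P Q
  assumes left_ideal_P: "left_ideal P R" and left_ideal_Q: "left_ideal Q R"
    and one_notin_P: "\<one> \<notin> P" and one_notin_Q: "\<one> \<notin> Q"
    and one_in_sum: "\<one> \<in> P <+>\<^bsub>R\<^esub> Q"
    and proper_subset: "\<And>N. left_ideal N R \<Longrightarrow> \<one> \<notin> N \<Longrightarrow> N \<subseteq> P \<or> N \<subseteq> Q"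
begin

lemma one_mem_of_both_subset: 
  assumes "left_ideal N R" "P \<subseteq> N" "Q \<subseteq> N"
  shows "\<one> \<in> N"
proof -
  obtain p q where "p \<in> P" "q \<in> Q" "\<one> = p \<oplus> q" using one_in_sum by (rule mem_set_addE)
  then show ?thesis using assms unfolding left_ideal_iff by (metis subsetD)
qed

lemma not_subset: "\<not> P \<subseteq> Q" "\<not> Q \<subseteq> P"
  using one_mem_of_both_subset[OF left_ideal_Q] one_mem_of_both_subset[OF left_ideal_P] one_notin_P one_notin_Q by auto

lemma maximal_submodule_iff:
  "maximal_submodule K R (regular_module R) \<longleftrightarrow> K = P \<or> K = Q"
proof
  assume K: "maximal_submodule K R (regular_module R)"
  then have "left_ideal K R" "\<one> \<notin> K"
    using left_ideal_one by (auto simp: maximal_submodule_def)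
  then have "K \<subseteq> P \<or> K \<subseteq> Q" by (rule proper_subset)
  moreover have "P \<noteq> carrier R" "Q \<noteq> carrier R" using one_notin_P one_notin_Q by auto
  ultimately show "K = P \<or> K = Q"
    using K left_ideal_P left_ideal_Q unfolding maximal_submodule_def regular_module_simps by metis
next
  have max: "X = P' \<or> X = carrier R"
    if "left_ideal X R" "P' \<subseteq> X" "P' = P \<or> P' = Q" for X P'
  proof (cases "\<one> \<in> X")
    case True
    then show ?thesis using left_ideal_one[OF that(1)] by simp
  next
    case False
    then show ?thesis using proper_subset[OF that(1)] that(2,3) not_subset by blast
  qed
  assume "K = P \<or> K = Q"
  then show "maximal_submodule K R (regular_module R)"
    using max left_ideal_P left_ideal_Q one_notin_P one_notin_Q
    unfolding maximal_submodule_def regular_module_simps by (metis one_closed)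
qed

lemma Jac_eq: "Jac R = P \<inter> Q"
  using left_ideal_P unfolding Jac_def Rad_def maximal_submodule_iff left_ideal_iff by auto

lemma semilocal: "semilocal_ring R"
proof (rule semilocal_ringI)
  fix N assume N: "left_ideal N R" "Jac R \<subseteq> N"
  have R: "left_ideal (carrier R) R" by (simp add: left_ideal_iff)
  have Z: "left_ideal {\<zero>} R" by (simp add: left_ideal_iff)
  \<comment> \<open>A sum of left ideals is the whole ring as soon as neither \<open>P\<close> nor \<open>Q\<close> contains both summands.\<close>
  have sum: "N <+>\<^bsub>R\<^esub> L = carrier R" if L: "left_ideal L R" "\<not> (N \<subseteq> P \<and> L \<subseteq> P)" "\<not> (N \<subseteq> Q \<and> L \<subseteq> Q)" for L
    using left_ideal_one[OF left_ideal_set_add[OF N(1) L(1)]] L(2,3)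
      proper_subset[OF left_ideal_set_add[OF N(1) L(1)]] left_ideal_subset_set_add[OF N(1) L(1)]
    by blast
  have "\<exists>L. left_ideal L R \<and> \<not> (N \<subseteq> P \<and> L \<subseteq> P) \<and> \<not> (N \<subseteq> Q \<and> L \<subseteq> Q) \<and> N \<inter> L \<subseteq> P \<inter> Q"
  proof -
    consider "N \<subseteq> P" "N \<subseteq> Q" | "N \<subseteq> P" "\<not> N \<subseteq> Q" | "\<not> N \<subseteq> P" "N \<subseteq> Q" | "\<not> N \<subseteq> P" "\<not> N \<subseteq> Q"
      by blast
    then show ?thesis
    proof cases
      case 1 then show ?thesis using R one_notin_P one_notin_Q by (intro exI[of _ "carrier R"]) auto
    next
      case 2 then show ?thesis using left_ideal_Q not_subset by (intro exI[of _ Q]) auto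
    next
      case 3 then show ?thesis using left_ideal_P not_subset by (intro exI[of _ P]) auto
    next
      case 4 then show ?thesis 
        using Z left_ideal_P left_ideal_Q unfolding left_ideal_iff by (intro exI[of _ "{\<zero>}"]) auto
    qed
  qed
  then show "\<exists>L. left_ideal L R \<and> N <+>\<^bsub>R\<^esub> L = carrier R \<and> N \<inter> L \<subseteq> Jac R"
    using sum unfolding Jac_eq by blast
qed

end

section \<open>Subrings of the real numbers\<close>

definition real_ring :: "real set \<Rightarrow> real ring" where
  "real_ring A = \<lparr>carrier = A, mult = (*), one = 1, zero = 0, add = (+)\<rparr>"

lemma real_ring_simps [simp]:
  "carrier (real_ring A) = A" "mult (real_ring A) = (*)" "one (real_ring A) = 1"
  "zero (real_ring A) = 0" "add (real_ring A) = (+)"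
  by (simp_all add: real_ring_def)

locale real_subring =
  fixes A :: "real set"
  assumes one_mem: "1 \<in> A"
    and diff_mem: "x \<in> A \<Longrightarrow> y \<in> A \<Longrightarrow> x - y \<in> A"
    and mult_mem: "x \<in> A \<Longrightarrow> y \<in> A \<Longrightarrow> x * y \<in> A"
begin

lemma zero_mem: "0 \<in> A"
  using diff_mem[OF one_mem one_mem] by simp

lemma uminus_mem: "x \<in> A \<Longrightarrow> - x \<in> A"
  using diff_mem[OF zero_mem] by simp

lemma add_mem: "x \<in> A \<Longrightarrow> y \<in> A \<Longrightarrow> x + y \<in> A"
  using diff_mem[OF _ uminus_mem] by force

lemma of_nat_mem: "of_nat n \<in> A"
  by (induction n) (auto intro: add_mem zero_mem one_mem)

lemma of_int_mem: "of_int k \<in> A"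
  by (cases k rule: int_cases2) (auto intro: of_nat_mem uminus_mem)

lemma numeral_mem: "numeral k \<in> A"
  using of_nat_mem[of "numeral k"] by simp

lemma power_mem: "x \<in> A \<Longrightarrow> x ^ n \<in> A"
  by (induction n) (auto intro: one_mem mult_mem)

lemma sum_mem: "(\<And>i. i \<in> I \<Longrightarrow> f i \<in> A) \<Longrightarrow> sum f I \<in> A"
  by (induction I rule: infinite_finite_induct) (auto intro: zero_mem add_mem)

lemma ring_real_ring: "ring (real_ring A)"
proof (rule ringI)
  show "abelian_group (real_ring A)"
    by (rule abelian_groupI) (auto intro: add_mem zero_mem bexI[OF _ uminus_mem])
  show "Group.monoid (real_ring A)"
    by (rule Group.monoidI) (auto intro: mult_mem one_mem)
qed (auto simp: algebra_simps)

sublocale ring "real_ring A" by (rule ring_real_ring)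

lemma a_minus_real_ring: "x \<in> A \<Longrightarrow> y \<in> A \<Longrightarrow> x \<ominus>\<^bsub>real_ring A\<^esub> y = x - y"
  using add_minus_cancel(1)[of "x - y" y] diff_mem by simp

lemma left_ideal_real_ring_iff:
  "left_ideal N (real_ring A) \<longleftrightarrow> N \<subseteq> A \<and> 0 \<in> N \<and>
    (\<forall>x\<in>N. \<forall>y\<in>N. x + y \<in> N) \<and> (\<forall>a\<in>A. \<forall>x\<in>N. a * x \<in> N)"
  using left_ideal_iff by simp

end

section \<open>The integers localized at two and three\<close>

text \<open>
  The integers localized at the complement of the union of the prime ideals generated by 2 and 3.
\<close>

definition Z23 :: "real set" where
  "Z23 = {x. \<exists>a b. x = of_int a / of_int b \<and> odd b \<and> \<not> 3 dvd b}"

lemma Z23I: "odd b \<Longrightarrow> \<not> 3 dvd b \<Longrightarrow> of_int a / of_int b \<in> Z23"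
  unfolding Z23_def by blast

lemma not_three_dvd_mult:
  fixes b d :: int
  assumes "\<not> 3 dvd b" "\<not> 3 dvd d"
  shows "\<not> 3 dvd b * d"
proof -
  have "b mod 3 = 1 \<or> b mod 3 = 2" "d mod 3 = 1 \<or> d mod 3 = 2" using assms by presburger+
  then have "(b mod 3) * (d mod 3) mod 3 \<noteq> 0" by auto
  then show ?thesis by (simp add: dvd_eq_mod_eq_0 mod_mult_eq)
qed

interpretation Z23: real_subring Z23
proof
  show "1 \<in> Z23" using Z23I[of 1 1] by simp
  fix x y assume "x \<in> Z23" "y \<in> Z23"
  then obtain a b c d where x: "x = of_int a / of_int b" "odd b" "\<not> 3 dvd b"
      and y: "y = of_int c / of_int d" "odd d" "\<not> 3 dvd d"
    unfolding Z23_def by blast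
  then have bd: "odd (b * d)" "\<not> 3 dvd b * d" "b \<noteq> 0" "d \<noteq> 0"
    using not_three_dvd_mult by auto
  have "x - y = of_int (a * d - c * b) / of_int (b * d)"
    using bd(3,4) unfolding x(1) y(1) by (simp add: field_simps)
  then show "x - y \<in> Z23" using Z23I[OF bd(1,2)] by metis
  have "x * y = of_int (a * c) / of_int (b * d)" using x y by simp
  then show "x * y \<in> Z23" using Z23I[OF bd(1,2)] by metis
qed

lemma half_notin_Z23: "1 / 2 \<notin> Z23"
proof
  assume "1 / 2 \<in> Z23"
  then obtain a b where "1 / 2 = (of_int a / of_int b :: real)" "odd b" unfolding Z23_def by blast
  moreover have "b \<noteq> 0" using \<open>odd b\<close> by auto
  ultimately have "of_int b = (of_int (2 * a) :: real)" by (simp add: field_simps)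
  then have "b = 2 * a" unfolding of_int_eq_iff .
  then show False using \<open>odd b\<close> by simp
qed

lemma two_thirds_notin_Z23: "2 / 3 \<notin> Z23"
proof
  assume "2 / 3 \<in> Z23"
  then obtain a b where "2 / 3 = (of_int a / of_int b :: real)" "\<not> 3 dvd b" "odd b"
    unfolding Z23_def by blast
  moreover have "b \<noteq> 0" using \<open>odd b\<close> by auto
  ultimately have "of_int (2 * b) = (of_int (3 * a) :: real)" by (simp add: field_simps)
  then have "2 * b = 3 * a" unfolding of_int_eq_iff .
  then show False using \<open>\<not> 3 dvd b\<close> by presburger
qed

text \<open>
  Each ideal is generated by its integral elements, because denominators are units.
\<close>

lemma left_ideal_Z23_principal:
  assumes N: "left_ideal N (real_ring Z23)"
  obtains c :: int where "N = (*) (of_int c) ` Z23"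
proof -
  note N' = N[unfolded Z23.left_ideal_real_ring_iff]
  define I where "I = {a :: int. of_int a \<in> N}"
  have I_mult: "a * b \<in> I" if "b \<in> I" for a b
    using N' that Z23.of_int_mem[of a] by (simp add: I_def)
  have I_add: "a + b \<in> I" if "a \<in> I" "b \<in> I" for a b
    using N' that by (simp add: I_def)
  have "\<exists>c\<in>I. \<forall>a\<in>I. c dvd a"
  proof (cases "\<exists>n::nat. 0 < n \<and> int n \<in> I")
    case True
    define d where "d = (LEAST n::nat. 0 < n \<and> int n \<in> I)"
    have d: "0 < d" "int d \<in> I" using LeastI_ex[OF True] unfolding d_def by auto
    have "int d dvd a" if a: "a \<in> I" for a
    proof (rule ccontr)
      assume "\<not> int d dvd a"
      then have "a mod int d \<noteq> 0" by (simp add: dvd_eq_mod_eq_0)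
      moreover have "0 \<le> a mod int d" "a mod int d < int d" using d(1) by simp_all
      ultimately have r: "0 < a mod int d" "a mod int d < int d" by linarith+
      have "a + (- (a div int d)) * int d \<in> I" by (rule I_add[OF a I_mult[OF d(2)]])
      then have "a mod int d \<in> I" by (simp add: minus_div_mult_eq_mod)
      then have "0 < nat (a mod int d) \<and> int (nat (a mod int d)) \<in> I" using r by simp
      then have "d \<le> nat (a mod int d)"
        using Least_le[of "\<lambda>n. 0 < n \<and> int n \<in> I"] unfolding d_def by blast
      then show False using r by linarith
    qed
    then show ?thesis using d by blast
  next
    case False
    have "a = 0" if "a \<in> I" for a
    proof (rule ccontr)
      assume "a \<noteq> 0"
      moreover have "-1 * a \<in> I" by (rule I_mult[OF that])
      ultimately have "0 < nat \<bar>a\<bar>" "int (nat \<bar>a\<bar>) \<in> I" using that by (auto simp: abs_if)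
      then show False using False by blast
    qed
    moreover have "0 \<in> I" using N' by (simp add: I_def)
    ultimately show ?thesis by auto
  qed
  then obtain c where c: "c \<in> I" "\<And>a. a \<in> I \<Longrightarrow> c dvd a" by blast
  show thesis
  proof
    show "N = (*) (of_int c) ` Z23"
    proof
      show "(*) (of_int c) ` Z23 \<subseteq> N" 
        using N' c(1) by (auto simp: I_def mult.commute)
      show "N \<subseteq> (*) (of_int c) ` Z23"
      proof
        fix x assume x: "x \<in> N"
        then obtain a b where ab: "x = of_int a / of_int b" "odd b" "\<not> 3 dvd b"
          using N' unfolding Z23_def by blast
        have "of_int a = of_int b * x" using ab by auto
        then have "a \<in> I" using N' x Z23.of_int_mem[of b] by (simp add: I_def)
        then obtain m where "a = c * m" using c(2) by (blast elim: dvdE)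
        then have "x = of_int c * (of_int m / of_int b)" using ab by simp
        then show "x \<in> (*) (of_int c) ` Z23" using Z23I[OF ab(2,3)] by blast
      qed
    qed
  qed
qed

interpretation Z23: two_maximal_left_ideals "real_ring Z23" "(*) 2 ` Z23" "(*) 3 ` Z23"
proof (intro two_maximal_left_ideals.intro two_maximal_left_ideals_axioms.intro)
  show "ring (real_ring Z23)" by (rule Z23.ring_real_ring)
  have ideal: "left_ideal ((*) c ` Z23) (real_ring Z23)" if "c \<in> Z23" for c
    unfolding Z23.left_ideal_real_ring_iff
  proof (intro conjI ballI)
    show "(*) c ` Z23 \<subseteq> Z23" using that Z23.mult_mem by auto
    show "0 \<in> (*) c ` Z23" using Z23.zero_mem by (auto intro: image_eqI[of _ _ 0])
    show "x + y \<in> (*) c ` Z23" if "x \<in> (*) c ` Z23" "y \<in> (*) c ` Z23" for x y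
      using that Z23.add_mem by (auto simp flip: distrib_left)
    show "a * x \<in> (*) c ` Z23" if "a \<in> Z23" "x \<in> (*) c ` Z23" for a x
      using that Z23.mult_mem by (auto simp: mult.left_commute)
  qed
  then show "left_ideal ((*) 2 ` Z23) (real_ring Z23)" "left_ideal ((*) 3 ` Z23) (real_ring Z23)"
    using Z23.numeral_mem by blast+
  show "\<one>\<^bsub>real_ring Z23\<^esub> \<notin> (*) 2 ` Z23"
  proof
    assume "\<one>\<^bsub>real_ring Z23\<^esub> \<in> (*) 2 ` Z23"
    then obtain x where "x \<in> Z23" "1 = 2 * x" by auto
    then have "x = 1 / 2" by simp
    then show False using half_notin_Z23 \<open>x \<in> Z23\<close> by blast
  qed
  show "\<one>\<^bsub>real_ring Z23\<^esub> \<notin> (*) 3 ` Z23"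
  proof
    assume "\<one>\<^bsub>real_ring Z23\<^esub> \<in> (*) 3 ` Z23"
    then obtain x where "x \<in> Z23" "1 = 3 * x" by auto
    then have "2 * x = 2 / 3" by simp
    then show False using two_thirds_notin_Z23 Z23.mult_mem[OF Z23.numeral_mem \<open>x \<in> Z23\<close>] by metis
  qed
  have "(1::real) = 2 * (-1) + 3 * 1" by simp
  then show "\<one>\<^bsub>real_ring Z23\<^esub> \<in> (*) 2 ` Z23 <+>\<^bsub>real_ring Z23\<^esub> (*) 3 ` Z23"
    using Z23.one_mem Z23.uminus_mem[OF Z23.one_mem] unfolding mem_set_add_iff real_ring_simps by blast
  fix N assume N: "left_ideal N (real_ring Z23)" "\<one>\<^bsub>real_ring Z23\<^esub> \<notin> N"
  obtain c where c: "N = (*) (of_int c) ` Z23" using left_ideal_Z23_principal[OF N(1)] .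
  have sub: "N \<subseteq> (*) (of_int p) ` Z23" if p: "p dvd c" for p
  proof
    fix x assume "x \<in> N"
    then obtain z where z: "z \<in> Z23" "x = of_int c * z" using c by blast
    obtain m where "c = p * m" using p by (rule dvdE)
    then have "x = of_int p * (of_int m * z)" using z by simp
    then show "x \<in> (*) (of_int p) ` Z23" using Z23.mult_mem[OF Z23.of_int_mem z(1)] by blast
  qed
  show "N \<subseteq> (*) 2 ` Z23 \<or> N \<subseteq> (*) 3 ` Z23"
  proof (rule ccontr)
    assume "\<not> (N \<subseteq> (*) 2 ` Z23 \<or> N \<subseteq> (*) 3 ` Z23)"
    then have "odd c" "\<not> 3 dvd c"
      using sub[of 2, unfolded of_int_numeral] sub[of 3, unfolded of_int_numeral] by blast+
    then have "of_int 1 / of_int c \<in> Z23" by (rule Z23I)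
    moreover have "1 = of_int c * (of_int 1 / of_int c :: real)" using \<open>odd c\<close> by auto
    ultimately have "1 \<in> N" unfolding c by (rule image_eqI[rotated])
    then show False using N(2) by simp
  qed
qed

text \<open>
  Over a domain, a principal ideal with generator \<open>c \<noteq> 0\<close> is isomorphic to the ring, so its
  radical is \<open>c\<close> times the Jacobson radical. This is too small to contain \<open>2 c\<close>.
\<close>

theorem Z23_not_left_rad_supplemented: "\<not> left_rad_supplemented_ring (real_ring Z23)"
proof
  let ?R = "real_ring Z23"
  assume "left_rad_supplemented_ring ?R"
  then obtain L where L: "left_ideal L ?R" "(*) 2 ` Z23 <+>\<^bsub>?R\<^esub> L = Z23"
      "(*) 2 ` Z23 \<inter> L \<subseteq> Rad ?R (regular_module ?R\<lparr>carrier := L\<rparr>)"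
    using Z23.left_ideal_P unfolding Z23.left_rad_supplemented_ring_iff by auto
  obtain c where c: "L = (*) (of_int c) ` Z23" using left_ideal_Z23_principal[OF L(1)] .
  have "c \<noteq> 0"
  proof
    assume "c = 0"
    have "1 \<in> (*) 2 ` Z23 <+>\<^bsub>?R\<^esub> L" using L(2) Z23.one_mem by simp
    then obtain n l where "n \<in> (*) 2 ` Z23" "l \<in> L" "1 = n + l"
      by (rule mem_set_addE) simp
    then have "1 \<in> (*) 2 ` Z23" using c \<open>c = 0\<close> by auto
    then show False using Z23.one_notin_P by simp
  qed
  have "of_int c * 2 \<in> L" using c Z23.numeral_mem by blast
  moreover have "of_int c * 2 \<in> (*) 2 ` Z23" using Z23.of_int_mem by (simp add: mult.commute)
  ultimately have rad: "of_int c * 2 \<in> Rad ?R (regular_module ?R\<lparr>carrier := L\<rparr>)" using L(3) by blast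
  \<comment> \<open>Division by \<open>c\<close> is a homomorphism from \<open>L\<close> to the regular module.\<close>
  have "of_int c * 2 / of_int c \<in> Rad ?R (regular_module ?R)"
  proof (rule Rad_hom[where f = "\<lambda>x. x / of_int c", OF _ _ _ _ _ rad])
    show "left_module ?R (regular_module ?R\<lparr>carrier := L\<rparr>)"
      by (rule left_module.submodule_left_module[OF Z23.left_module_regular_module L(1)])
    show "x / of_int c \<in> carrier (regular_module ?R)"
      if "x \<in> carrier (regular_module ?R\<lparr>carrier := L\<rparr>)" for x
      using that c \<open>c \<noteq> 0\<close> by auto
  qed (simp_all add: Z23.left_module_regular_module add_divide_distrib)
  then have "2 \<in> (*) 3 ` Z23"
    using \<open>c \<noteq> 0\<close> Z23.Jac_eq unfolding Jac_def by simp
  then obtain x where "x \<in> Z23" "2 = 3 * x" by auto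
  then have "x = 2 / 3" by simp
  then show False using two_thirds_notin_Z23 \<open>x \<in> Z23\<close> by blast
qed

section \<open>A maximal real subring avoiding one half and one third\<close>

lemma maximal_subring_exists:
  obtains A where "real_subring A" "1 / 2 \<notin> A" "1 / 3 \<notin> A"
    and "\<And>B. real_subring B \<Longrightarrow> A \<subseteq> B \<Longrightarrow> 1 / 2 \<notin> B \<Longrightarrow> 1 / 3 \<notin> B \<Longrightarrow> B = A"
proof -
  let ?S = "{A. real_subring A \<and> 1 / 2 \<notin> A \<and> 1 / 3 \<notin> A}"
  have "\<exists>M\<in>?S. \<forall>X\<in>?S. M \<subseteq> X \<longrightarrow> X = M"
  proof (rule subset_Zorn_nonempty)
    have ints: "1 / of_int k \<notin> (\<int> :: real set)" if "1 < k" for k :: int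
    proof
      assume "1 / of_int k \<in> (\<int> :: real set)"
      then obtain m where "1 / of_int k = (of_int m :: real)" by (rule Ints_cases)
      then have "of_int (m * k) = (of_int 1 :: real)" using that by (simp add: field_simps)
      then have "m * k = 1" unfolding of_int_eq_iff .
      then show False using that by (auto simp: zmult_eq_1_iff)
    qed
    have "real_subring \<int>" by standard auto
    then have "\<int> \<in> ?S" using ints[of 2] ints[of 3] by simp
    then show "?S \<noteq> {}" by blast
  next
    fix C assume C: "C \<noteq> {}" "subset.chain ?S C"
    have mem: "real_subring X" "1 / 2 \<notin> X" "1 / 3 \<notin> X" if "X \<in> C" for X
      using C that by (auto simp: subset.chain_def)
    have "real_subring (\<Union>C)"
    proof
      show "1 \<in> \<Union>C" using C(1) mem(1) real_subring.one_mem by blast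
      fix x y assume xy: "x \<in> \<Union>C" "y \<in> \<Union>C"
      obtain X Y where X: "X \<in> C" "x \<in> X" "Y \<in> C" "y \<in> Y" using xy by blast
      then have "X \<subseteq> Y \<or> Y \<subseteq> X" using C(2) by (auto simp: subset.chain_def)
      then obtain Z where Z: "Z \<in> C" "x \<in> Z" "y \<in> Z" using X by blast
      then show "x - y \<in> \<Union>C" using real_subring.diff_mem[OF mem(1)[OF Z(1)]] by blast
      show "x * y \<in> \<Union>C" using real_subring.mult_mem[OF mem(1)[OF Z(1)]] Z by blast
    qed
    moreover have "1 / 2 \<notin> \<Union>C" "1 / 3 \<notin> \<Union>C" using mem(2,3) by blast+
    ultimately show "\<Union>C \<in> ?S" by blast
  qed
  then obtain A where A: "A \<in> ?S" "\<forall>X\<in>?S. A \<subseteq> X \<longrightarrow> X = A" by (rule bexE)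
  then show thesis by (intro that[of A]) auto
qed

locale maximal_subring = real_subring A for A +
  assumes half_notin: "1 / 2 \<notin> A" and third_notin: "1 / 3 \<notin> A"
    and maximal: "\<And>B. real_subring B \<Longrightarrow> A \<subseteq> B \<Longrightarrow> 1 / 2 \<notin> B \<Longrightarrow> 1 / 3 \<notin> B \<Longrightarrow> B = A"
begin

text \<open>
  If \<open>s\<^sup>2 = a\<close> and \<open>1/p = x + y s\<close> with \<open>x\<close> and \<open>y\<close> in \<open>A\<close>, then \<open>(1/p - x)\<^sup>2 = y\<^sup>2 a\<close>, and
  multiplication by \<open>p\<close> shows \<open>1/p \<in> A\<close>. Hence the extension of \<open>A\<close> by \<open>s\<close> contains neither
  \<open>1/2\<close> nor \<open>1/3\<close>, and by maximality it is \<open>A\<close>.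
\<close>

lemma sqrt_mem:
  assumes a: "a \<in> A" "0 \<le> a"
  shows "sqrt a \<in> A"
proof -
  define s where "s = sqrt a"
  have s: "s * s = a" using a by (simp add: s_def)
  define B where "B = {z. \<exists>x\<in>A. \<exists>y\<in>A. z = x + y * s}"
  have BI: "x + y * s \<in> B" if "x \<in> A" "y \<in> A" for x y
    using that unfolding B_def by blast
  have "real_subring B"
  proof
    show "1 \<in> B" using BI[OF one_mem zero_mem] by simp
    fix u v assume "u \<in> B" "v \<in> B"
    then obtain x y x' y' where u: "x \<in> A" "y \<in> A" "u = x + y * s"
      and v: "x' \<in> A" "y' \<in> A" "v = x' + y' * s"
      unfolding B_def by blast
    have "u - v = (x - x') + (y - y') * s" using u v by (simp add: algebra_simps)
    then show "u - v \<in> B" using BI[OF diff_mem[OF u(1) v(1)] diff_mem[OF u(2) v(2)]] by simp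
    have "u * v = x * x' + y * y' * (s * s) + (x * y' + y * x') * s"
      using u v by (simp add: algebra_simps)
    then have "u * v = (x * x' + y * y' * a) + (x * y' + y * x') * s"
      by (simp only: s)
    moreover have "x * x' + y * y' * a \<in> A" "x * y' + y * x' \<in> A"
      using u v a by (auto intro!: add_mem mult_mem)
    ultimately show "u * v \<in> B" using BI by simp
  qed
  moreover have "A \<subseteq> B" using BI[OF _ zero_mem] by auto
  moreover have inv: "1 / p \<notin> B" if p: "p \<in> A" "p \<noteq> 0" "1 / p \<notin> A" for p
  proof
    assume "1 / p \<in> B"
    then obtain x y where xy: "x \<in> A" "y \<in> A" "1 / p = x + y * s" unfolding B_def by blast
    then have "(1 / p - x) * (1 / p - x) = y * y * (s * s)" by (simp add: algebra_simps)
    then have "p * ((1 / p - x) * (1 / p - x)) = p * (y * y * a)" by (simp only: s)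
    moreover have "p * ((1 / p - x) * (1 / p - x)) = 1 / p - 2 * x + p * x * x"
      using p(2) by (simp add: field_simps)
    ultimately have "1 / p = 2 * x - p * x * x + p * y * y * a" by (simp add: mult.assoc)
    moreover have "2 * x - p * x * x + p * y * y * a \<in> A"
      using xy a p by (intro add_mem diff_mem mult_mem numeral_mem) auto
    ultimately show False using p(3) by simp
  qed
  moreover have "1 / 2 \<notin> B" "1 / 3 \<notin> B"
    using inv[of 2] inv[of 3] numeral_mem half_notin third_notin by auto
  ultimately have "B = A" using maximal by blast
  moreover have "s \<in> B" using BI[OF zero_mem one_mem] by simp
  ultimately show ?thesis by (simp add: s_def)
qed

text \<open>
  For \<open>p \<noteq> 0\<close> this is the radical of the principal ideal \<open>p A\<close>: the condition \<open>x ^ n / p \<in> A\<close> says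
  that \<open>x ^ n\<close> is a multiple of \<open>p\<close> in \<open>A\<close>.
\<close>

definition radical :: "real \<Rightarrow> real set" where
  "radical p = {x \<in> A. \<exists>n. x ^ n / p \<in> A}"

lemma left_ideal_radical: "left_ideal (radical p) (real_ring A)"
  unfolding left_ideal_real_ring_iff
proof (intro conjI ballI)
  show "radical p \<subseteq> A" by (auto simp: radical_def)
  have "0 ^ 1 / p \<in> A" using zero_mem by simp
  then show "0 \<in> radical p" using zero_mem unfolding radical_def by blast
next
  fix x y assume "x \<in> radical p" "y \<in> radical p"
  then obtain n m where x: "x \<in> A" "x ^ n / p \<in> A" and y: "y \<in> A" "y ^ m / p \<in> A"
    by (auto simp: radical_def)
  \<comment> \<open>Each term of the binomial expansion contains the factor \<open>x ^ n\<close> or the factor \<open>y ^ m\<close>.\<close>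
  have "of_nat (n + m choose i) * x ^ i * y ^ (n + m - i) / p \<in> A" if "i \<le> n + m" for i
  proof (cases "n \<le> i")
    case True
    then have "x ^ i = x ^ n * x ^ (i - n)" by (simp flip: power_add)
    then have "of_nat (n + m choose i) * x ^ i * y ^ (n + m - i) / p =
        of_nat (n + m choose i) * (x ^ n / p) * x ^ (i - n) * y ^ (n + m - i)" by simp
    also have "\<dots> \<in> A" using x y by (intro mult_mem of_nat_mem power_mem) auto
    finally show ?thesis .
  next
    case False
    then have "n + m - i = m + (n - i)" by simp
    then have "y ^ (n + m - i) = y ^ m * y ^ (n - i)" by (simp only: power_add)
    then have "of_nat (n + m choose i) * x ^ i * y ^ (n + m - i) / p =
        of_nat (n + m choose i) * x ^ i * (y ^ m / p) * y ^ (n - i)" by simp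
    also have "\<dots> \<in> A" using x y by (intro mult_mem of_nat_mem power_mem) auto
    finally show ?thesis .
  qed
  then have "(x + y) ^ (n + m) / p \<in> A"
    unfolding binomial_ring sum_divide_distrib by (intro sum_mem) auto
  then show "x + y \<in> radical p" using add_mem[OF x(1) y(1)] unfolding radical_def by blast
next
  fix a x assume a: "a \<in> A" and "x \<in> radical p"
  then obtain n where x: "x \<in> A" "x ^ n / p \<in> A" by (auto simp: radical_def)
  have "(a * x) ^ n / p = a ^ n * (x ^ n / p)" by (simp add: power_mult_distrib)
  also have "\<dots> \<in> A" using a x by (intro mult_mem power_mem)
  finally show "a * x \<in> radical p" using mult_mem[OF a x(1)] unfolding radical_def by blast
qed

lemma one_notin_radical: "1 / p \<notin> A \<Longrightarrow> 1 \<notin> radical p"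
  by (simp add: radical_def)

lemma self_mem_radical: 
  assumes "p \<in> A" shows "p \<in> radical p"
proof -
  have "p ^ 1 / p \<in> A" using one_mem zero_mem by (cases "p = 0") auto
  then show ?thesis using assms unfolding radical_def by blast
qed

text \<open>
  The localization \<open>A[1/x]\<close> is strictly larger than \<open>A\<close>, so by maximality it contains \<open>1/2\<close> or
  \<open>1/3\<close>; clearing denominators puts a power of \<open>x\<close> into \<open>2 A\<close> or \<open>3 A\<close>.
\<close>

lemma nonunit_mem_radical:
  assumes x: "x \<in> A" "x \<noteq> 0" "1 / x \<notin> A"
  shows "x \<in> radical 2 \<or> x \<in> radical 3"
proof -
  define B where "B = {z. \<exists>a\<in>A. \<exists>n. z = a / x ^ n}"
  have BI: "a / x ^ n \<in> B" if "a \<in> A" for a n using that unfolding B_def by blast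
  have "real_subring B"
  proof
    show "1 \<in> B" using BI[OF one_mem, of 0] by simp
    fix u v assume "u \<in> B" "v \<in> B"
    then obtain a b n m where u: "a \<in> A" "u = a / x ^ n" and v: "b \<in> A" "v = b / x ^ m"
      unfolding B_def by blast
    have "u - v = (a * x ^ m - b * x ^ n) / x ^ (n + m)"
      using \<open>x \<noteq> 0\<close> unfolding u(2) v(2) by (simp add: field_simps power_add)
    moreover have "a * x ^ m - b * x ^ n \<in> A"
      using u v x by (intro diff_mem mult_mem power_mem)
    ultimately show "u - v \<in> B" using BI by simp
    have "u * v = a * b / x ^ (n + m)" unfolding u(2) v(2) by (simp add: power_add)
    then show "u * v \<in> B" using BI[OF mult_mem[OF u(1) v(1)]] by simp
  qed
  moreover have "A \<subseteq> B" using BI[of _ 0] by auto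
  moreover have "1 / x \<in> B" using BI[OF one_mem, of 1] by simp
  ultimately have "1 / 2 \<in> B \<or> 1 / 3 \<in> B" using maximal x(3) by blast
  moreover have "x \<in> radical p" if "p \<noteq> 0" "1 / p \<in> B" for p
  proof -
    obtain a n where a: "a \<in> A" "1 / p = a / x ^ n" using \<open>1 / p \<in> B\<close> unfolding B_def by blast
    then have "x ^ n / p = a" using \<open>x \<noteq> 0\<close> \<open>p \<noteq> 0\<close> by (simp add: field_simps)
    then show ?thesis using a x unfolding radical_def by blast
  qed
  ultimately show ?thesis by auto
qed

sublocale two_maximal_left_ideals "real_ring A" "radical 2" "radical 3"
proof (intro two_maximal_left_ideals.intro two_maximal_left_ideals_axioms.intro)
  show "ring (real_ring A)" by (rule ring_real_ring)
  show "left_ideal (radical 2) (real_ring A)" "left_ideal (radical 3) (real_ring A)"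
    by (rule left_ideal_radical)+
  show "\<one>\<^bsub>real_ring A\<^esub> \<notin> radical 2" "\<one>\<^bsub>real_ring A\<^esub> \<notin> radical 3"
    using one_notin_radical half_notin third_notin by simp_all
  have "-1 * 2 \<in> radical 2"
    using left_ideal_radical self_mem_radical[OF numeral_mem] uminus_mem[OF one_mem]
    unfolding left_ideal_real_ring_iff by blast
  moreover have "3 \<in> radical 3" by (rule self_mem_radical[OF numeral_mem])
  moreover have "(1::real) = -1 * 2 + 3" by simp
  ultimately show "\<one>\<^bsub>real_ring A\<^esub> \<in> radical 2 <+>\<^bsub>real_ring A\<^esub> radical 3"
    unfolding mem_set_add_iff real_ring_simps by blast
  fix N assume N: "left_ideal N (real_ring A)" "\<one>\<^bsub>real_ring A\<^esub> \<notin> N"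
  note N' = N(1)[unfolded left_ideal_real_ring_iff]
  have cover: "x \<in> radical 2 \<or> x \<in> radical 3" if "x \<in> N" for x
  proof (cases "x = 0")
    case True
    then show ?thesis using left_ideal_radical unfolding left_ideal_real_ring_iff by blast
  next
    case False
    then have "1 / x * x = 1" by simp
    then have "1 / x \<notin> A" using N(2) N' that by (metis real_ring_simps(3))
    then show ?thesis using nonunit_mem_radical False that N' by blast
  qed
  show "N \<subseteq> radical 2 \<or> N \<subseteq> radical 3"
  proof (rule ccontr)
    \<comment> \<open>Prime avoidance for two ideals: \<open>x + y\<close> would lie in neither of them.\<close>
    assume "\<not> (N \<subseteq> radical 2 \<or> N \<subseteq> radical 3)"
    then obtain x y where xy: "x \<in> N" "x \<notin> radical 2" "y \<in> N" "y \<notin> radical 3" by blast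
    then have "x \<in> radical 3" "y \<in> radical 2" using cover by blast+
    have "x + y \<in> N" using xy N' by blast
    have minus: "u - v \<in> radical p" if "u \<in> radical p" "v \<in> radical p" for u v p
      using left_ideal_minus[OF left_ideal_radical that] that left_ideal_radical[of p]
      by (simp add: a_minus_real_ring left_ideal_real_ring_iff subset_iff)
    from cover[OF \<open>x + y \<in> N\<close>] show False
      using minus[of "x + y" 2 y] minus[of "x + y" 3 x] xy \<open>x \<in> radical 3\<close> \<open>y \<in> radical 2\<close> by auto
  qed
qed

text \<open>
  Here \<open>x = (sgn x * sqrt \<bar>x\<bar>) * sqrt \<bar>x\<bar>\<close>, and radical ideals contain the square roots of their
  elements.
\<close>

lemma Jac_idempotent:
  assumes "x \<in> Jac (real_ring A)"
  shows "\<exists>u\<in>Jac (real_ring A). \<exists>v\<in>Jac (real_ring A). x = u * v"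
proof -
  have "x \<in> A" using assms by (simp add: Jac_eq radical_def)
  define v where "v = sqrt \<bar>x\<bar>"
  have "\<bar>x\<bar> \<in> A" using \<open>x \<in> A\<close> uminus_mem by (simp add: abs_if)
  then have vA: "v \<in> A" unfolding v_def by (rule sqrt_mem) simp
  have v: "v ^ 2 = \<bar>x\<bar>" by (simp add: v_def)
  have "v \<in> radical p" if x: "x \<in> radical p" for p
  proof -
    obtain n where n: "x ^ n / p \<in> A" using x by (auto simp: radical_def)
    have "v ^ (2 * n) / p = \<bar>x\<bar> ^ n / p" by (simp add: power_mult v)
    also have "\<dots> = x ^ n / p \<or> \<dots> = - (x ^ n / p)"
      by (cases "x ^ n \<ge> 0") (simp_all flip: power_abs)
    ultimately have "v ^ (2 * n) / p \<in> A" using n uminus_mem by auto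
    then show ?thesis using vA unfolding radical_def by blast
  qed
  then have vJ: "v \<in> Jac (real_ring A)" using assms by (simp add: Jac_eq)
  have "sgn x \<in> A" using one_mem zero_mem uminus_mem by (simp add: sgn_if)
  then have "sgn x * v \<in> Jac (real_ring A)" using vJ left_ideal_Jac by (simp add: left_ideal_real_ring_iff)
  moreover have "x = sgn x * v * v"
    using v by (simp add: power2_eq_square mult.assoc mult_sgn_abs)
  ultimately show ?thesis using vJ by blast
qed

theorem left_rad_supplemented: "left_rad_supplemented_ring (real_ring A)"
  by (rule semilocal_Jac_idempotent_imp_left_rad_supplemented[OF semilocal])
    (simp add: Jac_idempotent)

text \<open>
  As \<open>3\<^sup>2 - 3 = 6\<close>, the element 3 is idempotent modulo the Jacobson radical. A domain offers only
  0 and 1 as lifts; these would put both 2 and 3 into one of the two maximal ideals.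
\<close>

theorem not_semiperfect: "\<not> semiperfect_ring (real_ring A)"
proof
  assume "semiperfect_ring (real_ring A)"
  then have lift: "\<forall>a\<in>A. a * a - a \<in> Jac (real_ring A) \<longrightarrow>
      (\<exists>e\<in>A. e * e = e \<and> e - a \<in> Jac (real_ring A))"
    unfolding semiperfect_ring_def idempotents_lift_Jac_iff
    by (auto simp: a_minus_real_ring mult_mem)
  note P = left_ideal_radical[of 2, unfolded left_ideal_real_ring_iff]
  note Q = left_ideal_radical[of 3, unfolded left_ideal_real_ring_iff]
  have 2: "2 \<in> radical 2" and 3: "3 \<in> radical 3" by (intro self_mem_radical numeral_mem)+
  have "3 * 2 \<in> radical 2" "2 * 3 \<in> radical 3" using P Q 2 3 numeral_mem by blast+
  then have "3 * 3 - 3 \<in> Jac (real_ring A)" by (simp add: Jac_eq)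
  then obtain e where e: "e * e = e" "e - 3 \<in> Jac (real_ring A)" using lift numeral_mem by blast
  have "e * (e - 1) = 0" using e(1) by (simp add: algebra_simps)
  then consider "e = 0" | "e = 1" by auto
  then show False
  proof cases
    case 1
    then have "-1 * (0 - 3) + -1 * 2 \<in> radical 2"
      using e(2) P 2 uminus_mem[OF one_mem] unfolding Jac_eq by blast
    then show False using one_notin_P by simp
  next
    case 2
    then have "(1 - 3) + 3 \<in> radical 3" using e(2) Q 3 unfolding Jac_eq by blast
    then show False using one_notin_Q by simp
  qed
qed

end

theorem mainTheorem1:
  shows "(\<forall>R :: ('a, 'm) ring_scheme. semiperfect_ring R \<longrightarrow> left_rad_supplemented_ring R) \<and>
         (\<forall>R :: ('a, 'm) ring_scheme. left_rad_supplemented_ring R \<longrightarrow> semilocal_ring R) \<and>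
         (\<exists>R :: real ring. semilocal_ring R \<and> \<not> left_rad_supplemented_ring R) \<and>
         (\<exists>R :: real ring. left_rad_supplemented_ring R \<and> \<not> semiperfect_ring R)"
proof (intro conjI allI impI)
  fix R :: "('a, 'm) ring_scheme"
  assume R: "semiperfect_ring R"
  then have "ring R" by (simp add: semiperfect_ring_def semilocal_ring_def)
  then show "left_rad_supplemented_ring R"
    using R by (rule ring.semiperfect_ring_imp_left_rad_supplemented)
next
  fix R :: "('a, 'm) ring_scheme"
  assume R: "left_rad_supplemented_ring R"
  then have "ring R" by (simp add: left_rad_supplemented_ring_def)
  then show "semilocal_ring R"
    using R by (rule ring.left_rad_supplemented_ring_imp_semilocal)
next
  show "\<exists>R :: real ring. semilocal_ring R \<and> \<not> left_rad_supplemented_ring R"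
    using Z23.semilocal Z23_not_left_rad_supplemented by blast
next
  obtain A where "real_subring A" "1 / 2 \<notin> A" "1 / 3 \<notin> A"
    and "\<And>B. real_subring B \<Longrightarrow> A \<subseteq> B \<Longrightarrow> 1 / 2 \<notin> B \<Longrightarrow> 1 / 3 \<notin> B \<Longrightarrow> B = A"
    using maximal_subring_exists by blast
  then interpret maximal_subring A
    by (intro maximal_subring.intro maximal_subring_axioms.intro)
  show "\<exists>R :: real ring. left_rad_supplemented_ring R \<and> \<not> semiperfect_ring R"
    using left_rad_supplemented not_semiperfect by blast
qed

end
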